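(* Let $F:\mathbb{R}^n\rightrightarrows\mathbb{R}^n$ be a multifunction satisfying (F1)-(F3) of the context, with bilateral minimal time function $T$, and let $\mathcal{R}=\{(x,y)\in\mathbb{R}^n\times\mathbb{R}^n: T(x,y)<+\infty\}$ be the reachable set. Let $(\alpha,\beta)\in\mathcal{R}$ with $\alpha\ne\beta$. Then $$\dim\widehat{N}_{\mathcal{R}(T(\alpha,\beta))}(\alpha,\beta)=\dim\widehat{N}_{\mathrm{epi}(T)}((\alpha,\beta),T(\alpha,\beta)),$$ where $\dim$ is the dimension of a cone as defined in the context.
   Context: $\|\cdot\|$ and $\langle\cdot,\cdot\rangle$ denote the Euclidean norm and inner product (also on product spaces), and $\bar B$ the closed unit ball of $\mathbb{R}^n$. Assumptions on $F:\mathbb{R}^n\rightrightarrows\mathbb{R}^n$: (F1) $F(x)$ is nonempty, compact and convex for every $x\in\mathbb{R}^n$. (F2) $F$ is locally Lipschitz: for every compact set $K\subset\mathbb{R}^n$ there is a constant $L=L(K)$ such that $F(x)\subset F(y)+L\|y-x\|\bar B$ for all $x,y\in K$. (F3) There are positive constants $\gamma,c$ such that for all $x\in\mathbb{R}^n$, $v\in F(x)$ implies $\|v\|\le\gamma\|x\|+c$. A trajectory of $F$ is an absolutely continuous function $x(\cdot)$ with $\dot x(t)\in F(x(t))$ for a.e. $t$ in its interval of definition. The bilateral minimal time function $T:\mathbb{R}^n\times\mathbb{R}^n\to[0,+\infty]$ is $T(\alpha,\beta)=\inf\{\tau\ge 0:\text{ there is a trajectory }x(\cdot)\text{ of }F\text{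 with }x(0)=\alpha,\ x(\tau)=\beta\}$, with $T(\alpha,\beta)=+\infty$ if there is no such trajectory. For $t>0$, $\mathcal{R}(t)=\{(x,y)\in\mathbb{R}^n\times\mathbb{R}^n: T(x,y)\le t\}$. The epigraph is $\mathrm{epi}(T)=\{((x,y),\mu)\in(\mathbb{R}^n\times\mathbb{R}^n)\times\mathbb{R}: T(x,y)<+\infty,\ \mu\ge T(x,y)\}$. For a closed set $S\subset\mathbb{R}^m$ and $x\in S$, the Fréchet normal cone to $S$ at $x$ is $$\widehat{N}_S(x)=\left\{\zeta\in\mathbb{R}^m:\ \limsup_{S\ni y\to x}\frac{\langle\zeta,y-x\rangle}{\|y-x\|}\le 0\right\}.$$ A subset $C$ of $\mathbb{R}^m$ is a cone if $\lambda x\in C$ for all $x\in C$ and $\lambda\ge 0$. A number $\kappa\in\mathbb{N}$ is said to be the dimension of a cone $C$, written $\dim C=\kappa$, if there exist $v_1,\dots,v_\kappa\in C$ which are linearly independent and such that for every $v\in C$ there exist nonnegative numbers $\lambda_1,\dots,\lambda_\kappa$ with $v=\lambda_1v_1+\cdots+\lambda_\kappa v_\kappa$. *)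

theory Defs
  imports "HOL-Analysis.Analysis"
begin

text \<open>
  Absolute continuity of a function (the library only has absolute continuity of measures).
  For a nonoverlapping finite family of compact intervals \<^term>\<open>k\<close>, the endpoints
  are \<^term>\<open>Inf k\<close> and \<^term>\<open>Sup k\<close>.
\<close>
definition absolutely_continuous_on :: "real set \<Rightarrow> (real \<Rightarrow> 'a::real_normed_vector) \<Rightarrow> bool" where
  "absolutely_continuous_on I f \<longleftrightarrow>
     (\<forall>\<epsilon>>0. \<exists>\<delta>>0. \<forall>D U. D division_of U \<and> U \<subseteq> I \<and> (\<Sum>k\<in>D. Sup k - Inf k) < \<delta> \<longrightarrow>
        (\<Sum>k\<in>D. norm (f (Sup k) - f (Inf k))) < \<epsilon>)"

definition trajectory_on ::
  "('a::euclidean_space \<Rightarrow> 'a set) \<Rightarrow> real set \<Rightarrow> (real \<Rightarrow> 'a) \<Rightarrow> bool" where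
  "trajectory_on F I x \<longleftrightarrow>
     absolutely_continuous_on I x \<and>
     (AE t in lebesgue_on I. \<exists>v\<in>F (x t). (x has_vector_derivative v) (at t within I))"

text \<open>The infimum is taken in \<^typ>\<open>ereal\<close>, so it is \<open>\<infinity>\<close> over the empty set.\<close>
definition min_time ::
  "('a::euclidean_space \<Rightarrow> 'a set) \<Rightarrow> 'a \<times> 'a \<Rightarrow> ereal" where
  "min_time F = (\<lambda>(\<alpha>, \<beta>).
     Inf (ereal ` {\<tau>. 0 \<le> \<tau> \<and> (\<exists>x. trajectory_on F {0..\<tau>} x \<and> x 0 = \<alpha> \<and> x \<tau> = \<beta>)}))"

definition reachable_set :: "('a::euclidean_space \<Rightarrow> 'a set) \<Rightarrow> ('a \<times> 'a) set" where
  "reachable_set F = {p. min_time F p < \<infinity>}"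

definition reachable_within ::
  "('a::euclidean_space \<Rightarrow> 'a set) \<Rightarrow> real \<Rightarrow> ('a \<times> 'a) set" where
  "reachable_within F t = {p. min_time F p \<le> ereal t}"

definition min_time_epi :: "('a::euclidean_space \<Rightarrow> 'a set) \<Rightarrow> (('a \<times> 'a) \<times> real) set" where
  "min_time_epi F = {(p, \<mu>). min_time F p < \<infinity> \<and> min_time F p \<le> ereal \<mu>}"

text \<open>
  The upper limit is taken over \<open>y \<in> S\<close> with \<open>y \<noteq> x\<close>; if \<^term>\<open>x\<close> is isolated in
  \<^term>\<open>S\<close>, it is \<open>-\<infinity>\<close> and every vector is normal.
\<close>
definition frechet_normal_cone :: "'a::euclidean_space set \<Rightarrow> 'a \<Rightarrow> 'a set" where
  "frechet_normal_cone S x =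
     {\<zeta>. Limsup (at x within S) (\<lambda>y. ereal (inner \<zeta> (y - x) / norm (y - x))) \<le> 0}"

text \<open>
  This is not the dimension of the linear span: only cones generated by linearly independent
  vectors have a dimension in this sense, so it is a relation rather than a function.
\<close>
definition has_cone_dim :: "'a::euclidean_space set \<Rightarrow> nat \<Rightarrow> bool" where
  "has_cone_dim C \<kappa> \<longleftrightarrow> cone C \<and>
     (\<exists>B\<subseteq>C. finite B \<and> card B = \<kappa> \<and> independent B \<and>
        (\<forall>v\<in>C. \<exists>c. (\<forall>b\<in>B. 0 \<le> c b) \<and> v = (\<Sum>b\<in>B. c b *\<^sub>R b)))"

end

theory Submission
  imports Defs
begin

text \<open>
  Write \<open>T\<close> for the minimal time from \<open>\<alpha>\<close> to \<open>\<beta>\<close> and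
  \<open>h(\<zeta>\<^sub>1) = max {-\<langle>\<zeta>\<^sub>1, v\<rangle> | v \<in> F \<alpha>}\<close>. The normal cone to the epigraph is the
  graph of \<open>(\<zeta>\<^sub>1, \<zeta>\<^sub>2) \<mapsto> -h(\<zeta>\<^sub>1)\<close> over the normal cone to the sublevel set. Prepending a
  short trajectory that arrives with velocity \<open>v \<in> F \<alpha>\<close> and following a nearly optimal
  trajectory from \<open>\<alpha>\<close> give the two inequalities that pin down the last component of a normal;
  conversely, the same two moves carry a point of the epigraph near \<open>(\<alpha>, \<beta>, T)\<close> into the
  sublevel set with an error of second order. Since both cones are convex, \<open>h\<close> is additive on
  the normal cone to the sublevel set, so the graph map carries linearly independent generators
  to linearly independent generators and back.
\<close>

subsection \<open>Absolutely continuous functions\<close>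

text \<open>\<open>min_time\<close> is an infimum that is never shown to be attained, and no
  continuity of it is available, so times are compared only through actual trajectories whose
  duration carries some slack. A slack of order \<open>s\<^sup>2\<close> is harmless because the
  first order terms decide. Both moves take place at the initial point and leave the terminal point
  fixed, which is why \<open>h\<close> involves \<open>\<zeta>\<^sub>1\<close> only. Moving backward
  needs an existence theorem that controls the velocity; moving forward needs a bound on the
  displacement of every trajectory, and this rests on a mean value inequality for absolutely
  continuous functions. The assumption \<alpha> \<noteq> \<beta> enters as \<open>T > 0\<close>: it
  leaves room to follow a near optimal trajectory for a short time, and this gives
  \<open>h \<ge> 0\<close> on the normals to the sublevel set. That sign is what permits replacing
  the time actually spent by a larger bound in the converse inclusion.\<close>

lemma inner_le_norm_mult:
  fixes v :: "'a::real_inner"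
  assumes "norm v \<le> M"
  shows "inner \<zeta> v \<le> norm \<zeta> * M"
  using norm_cauchy_schwarz assms by (rule order_trans[OF _ mult_left_mono]) simp

lemma division_of_real_interval:
  fixes D :: "real set set"
  assumes "D division_of U" "k \<in> D"
  obtains u v where "k = {u..v}" "u \<le> v" "Inf k = u" "Sup k = v"
proof -
  obtain u v where "k = cbox u v" "cbox u v \<noteq> {}"
    using assms by (metis division_ofD(3,4))
  then show ?thesis
    by (intro that[of u v]) auto
qed

lemma absolutely_continuous_onI:
  fixes f :: "real \<Rightarrow> 'a::real_normed_vector"
  assumes "\<And>\<epsilon>. \<epsilon> > 0 \<Longrightarrow> \<exists>\<delta>>0. \<forall>D U. D division_of U \<longrightarrow> U \<subseteq> I \<longrightarrow> (\<Sum>k\<in>D. Sup k - Inf k) < \<delta> \<longrightarrow>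
        (\<Sum>k\<in>D. norm (f (Sup k) - f (Inf k))) < \<epsilon>"
  shows "absolutely_continuous_on I f"
  unfolding absolutely_continuous_on_def imp_conjL by (intro allI impI) (rule assms)

text \<open>The last clause is the definition applied to a one-member division; it supplies
  continuity and handles an interval that is cut at an interior point.\<close>

lemma absolutely_continuous_onE:
  fixes f :: "real \<Rightarrow> 'a::real_normed_vector"
  assumes "absolutely_continuous_on I f" "\<epsilon> > 0"
  obtains \<delta> where "\<delta> > 0"
    "\<forall>D U. D division_of U \<longrightarrow> U \<subseteq> I \<longrightarrow> (\<Sum>k\<in>D. Sup k - Inf k) < \<delta> \<longrightarrow>
        (\<Sum>k\<in>D. norm (f (Sup k) - f (Inf k))) < \<epsilon>"
    "\<forall>u v. u \<le> v \<longrightarrow> {u..v} \<subseteq> I \<longrightarrow> v - u < \<delta> \<longrightarrow> norm (f v - f u) < \<epsilon>"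
proof -
  from assms(1)[unfolded absolutely_continuous_on_def imp_conjL, THEN spec, THEN mp, OF assms(2)]
  obtain \<delta> where \<delta>0: "\<delta> > 0" and
    \<delta>: "\<forall>D U. D division_of U \<longrightarrow> U \<subseteq> I \<longrightarrow> (\<Sum>k\<in>D. Sup k - Inf k) < \<delta> \<longrightarrow>
        (\<Sum>k\<in>D. norm (f (Sup k) - f (Inf k))) < \<epsilon>"
    by (elim exE conjE)
  show thesis
  proof (rule that[OF \<delta>0 \<delta>], intro allI impI)
    fix u v :: real assume uv: "u \<le> v" "{u..v} \<subseteq> I" "v - u < \<delta>"
    have "{{u..v}} division_of {u..v}"
      using division_of_self[of u v] uv by simp
    then show "norm (f v - f u) < \<epsilon>"
      using \<delta>[rule_format, of "{{u..v}}" "{u..v}"] uv by simp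
  qed
qed

lemma absolutely_continuous_on_subset_cong:
  fixes f :: "real \<Rightarrow> 'a::real_normed_vector"
  assumes ac: "absolutely_continuous_on I f" and sub: "J \<subseteq> I" and eq: "\<And>t. t \<in> J \<Longrightarrow> f t = g t"
  shows "absolutely_continuous_on J g"
proof (rule absolutely_continuous_onI)
  fix \<epsilon> :: real assume "\<epsilon> > 0"
  from ac this obtain \<delta> where \<delta>: "\<delta> > 0"
    "\<forall>D U. D division_of U \<longrightarrow> U \<subseteq> I \<longrightarrow> (\<Sum>k\<in>D. Sup k - Inf k) < \<delta> \<longrightarrow>
        (\<Sum>k\<in>D. norm (f (Sup k) - f (Inf k))) < \<epsilon>"
    "\<forall>u v. u \<le> v \<longrightarrow> {u..v} \<subseteq> I \<longrightarrow> v - u < \<delta> \<longrightarrow> norm (f v - f u) < \<epsilon>"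
    by (rule absolutely_continuous_onE)
  have "(\<Sum>k\<in>D. norm (g (Sup k) - g (Inf k))) < \<epsilon>"
    if D: "D division_of U" "U \<subseteq> J" "(\<Sum>k\<in>D. Sup k - Inf k) < \<delta>" for D U
  proof -
    have "norm (f (Sup k) - f (Inf k)) = norm (g (Sup k) - g (Inf k))" if k: "k \<in> D" for k
    proof -
      obtain u v where uv: "k = {u..v}" "u \<le> v" "Inf k = u" "Sup k = v"
        using division_of_real_interval[OF D(1) k] .
      have "k \<subseteq> J"
        using D k division_ofD(2) by blast
      then have "u \<in> J" "v \<in> J"
        using uv by auto
      then show ?thesis
        using uv eq by simp
    qed
    then show ?thesis
      using \<delta>(2)[rule_format, OF D(1) order_trans[OF D(2) sub] D(3)] by simp
  qed
  then show "\<exists>\<delta>>0. \<forall>D U. D division_of U \<longrightarrow> U \<subseteq> J \<longrightarrow> (\<Sum>k\<in>D. Sup k - Inf k) < \<delta> \<longrightarrow>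
      (\<Sum>k\<in>D. norm (g (Sup k) - g (Inf k))) < \<epsilon>"
    using \<delta>(1) by (intro exI[of _ \<delta>]) simp
qed

lemma lipschitz_imp_absolutely_continuous_on:
  fixes f :: "real \<Rightarrow> 'a::real_normed_vector"
  assumes lip: "\<And>u v. u \<in> I \<Longrightarrow> v \<in> I \<Longrightarrow> u \<le> v \<Longrightarrow> norm (f v - f u) \<le> M * (v - u)"
  shows "absolutely_continuous_on I f"
proof (rule absolutely_continuous_onI)
  fix \<epsilon> :: real assume "\<epsilon> > 0"
  \<comment> \<open>The summand 1 keeps the denominator positive when \<open>M\<close> vanishes, the
    absolute value when \<open>M\<close> is negative.\<close>
  define \<delta> where "\<delta> = \<epsilon> / (\<bar>M\<bar> + 1)"
  have "\<delta> > 0"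
    using \<open>\<epsilon> > 0\<close> by (simp add: \<delta>_def)
  moreover have "(\<Sum>k\<in>D. norm (f (Sup k) - f (Inf k))) < \<epsilon>"
    if D: "D division_of U" "U \<subseteq> I" "(\<Sum>k\<in>D. Sup k - Inf k) < \<delta>" for D U
  proof -
    have "(\<Sum>k\<in>D. norm (f (Sup k) - f (Inf k))) \<le> (\<Sum>k\<in>D. (\<bar>M\<bar> + 1) * (Sup k - Inf k))"
    proof (rule sum_mono)
      fix k assume k: "k \<in> D"
      obtain u v where uv: "k = {u..v}" "u \<le> v" "Inf k = u" "Sup k = v"
        using division_of_real_interval[OF D(1) k] .
      moreover have "k \<subseteq> I"
        using D k division_ofD(2) by blast
      ultimately have "norm (f v - f u) \<le> M * (v - u)"
        by (intro lip) auto
      also have "\<dots> \<le> (\<bar>M\<bar> + 1) * (v - u)"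
        using uv by (intro mult_right_mono) auto
      finally show "norm (f (Sup k) - f (Inf k)) \<le> (\<bar>M\<bar> + 1) * (Sup k - Inf k)"
        using uv by simp
    qed
    also have "\<dots> = (\<bar>M\<bar> + 1) * (\<Sum>k\<in>D. Sup k - Inf k)"
      by (simp add: sum_distrib_left)
    also have "\<dots> < (\<bar>M\<bar> + 1) * \<delta>"
      using D(3) by (intro mult_strict_left_mono) auto
    finally show ?thesis
      by (simp add: \<delta>_def)
  qed
  ultimately show "\<exists>\<delta>>0. \<forall>D U. D division_of U \<longrightarrow> U \<subseteq> I \<longrightarrow> (\<Sum>k\<in>D. Sup k - Inf k) < \<delta> \<longrightarrow>
      (\<Sum>k\<in>D. norm (f (Sup k) - f (Inf k))) < \<epsilon>"
    by (intro exI[of _ \<delta>]) simp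
qed

lemma absolutely_continuous_on_imp_continuous_on:
  fixes f :: "real \<Rightarrow> 'a::real_normed_vector"
  assumes "absolutely_continuous_on {a..b} f"
  shows "continuous_on {a..b} f"
  unfolding continuous_on_iff
proof (intro ballI allI impI)
  fix t and \<epsilon> :: real assume t: "t \<in> {a..b}" and "\<epsilon> > 0"
  from assms \<open>\<epsilon> > 0\<close> obtain \<delta> where \<delta>: "\<delta> > 0"
    "\<forall>D U. D division_of U \<longrightarrow> U \<subseteq> {a..b} \<longrightarrow> (\<Sum>k\<in>D. Sup k - Inf k) < \<delta> \<longrightarrow>
        (\<Sum>k\<in>D. norm (f (Sup k) - f (Inf k))) < \<epsilon>"
    "\<forall>u v. u \<le> v \<longrightarrow> {u..v} \<subseteq> {a..b} \<longrightarrow> v - u < \<delta> \<longrightarrow> norm (f v - f u) < \<epsilon>"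
    by (rule absolutely_continuous_onE)
  have "dist (f t') (f t) < \<epsilon>" if "t' \<in> {a..b}" "dist t' t < \<delta>" for t'
  proof (cases "t' \<le> t")
    case True
    then have "norm (f t - f t') < \<epsilon>"
      using that t by (intro \<delta>(3)[rule_format]) (auto simp: dist_real_def)
    then show ?thesis
      by (simp add: dist_norm norm_minus_commute)
  next
    case False
    then have "norm (f t' - f t) < \<epsilon>"
      using that t by (intro \<delta>(3)[rule_format]) (auto simp: dist_real_def)
    then show ?thesis
      by (simp add: dist_norm)
  qed
  then show "\<exists>d>0. \<forall>t'\<in>{a..b}. dist t' t < d \<longrightarrow> dist (f t') (f t) < \<epsilon>"
    using \<delta>(1) by blast
qed

lemma absolutely_continuous_on_shift:
  fixes f :: "real \<Rightarrow> 'a::real_normed_vector"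
  assumes "absolutely_continuous_on ((+) c ` I) f"
  shows "absolutely_continuous_on I (\<lambda>t. f (c + t))"
proof (rule absolutely_continuous_onI)
  fix \<epsilon> :: real assume "\<epsilon> > 0"
  from assms this obtain \<delta> where \<delta>: "\<delta> > 0"
    "\<forall>D U. D division_of U \<longrightarrow> U \<subseteq> (+) c ` I \<longrightarrow> (\<Sum>k\<in>D. Sup k - Inf k) < \<delta> \<longrightarrow>
        (\<Sum>k\<in>D. norm (f (Sup k) - f (Inf k))) < \<epsilon>"
    "\<forall>u v. u \<le> v \<longrightarrow> {u..v} \<subseteq> (+) c ` I \<longrightarrow> v - u < \<delta> \<longrightarrow> norm (f v - f u) < \<epsilon>"
    by (rule absolutely_continuous_onE)
  have "(\<Sum>k\<in>D. norm (f (c + Sup k) - f (c + Inf k))) < \<epsilon>"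
    if D: "D division_of U" "U \<subseteq> I" "(\<Sum>k\<in>D. Sup k - Inf k) < \<delta>" for D U
  proof -
    let ?D = "(`) ((+) c) ` D"
    have div: "?D division_of (+) c ` U"
    proof (rule division_ofI)
      show "finite ?D"
        using D(1) by blast
      show "\<Union>?D = (+) c ` U"
        using division_ofD(6)[OF D(1)] by (metis image_Union)
      fix K assume "K \<in> ?D"
      then obtain k where k: "k \<in> D" "K = (+) c ` k"
        by blast
      show "K \<subseteq> (+) c ` U"
        using k division_ofD(2)[OF D(1)] by blast
      obtain u v where uv: "k = {u..v}" "u \<le> v" "Inf k = u" "Sup k = v"
        using division_of_real_interval[OF D(1) k(1)] .
      show "K \<noteq> {}"
        using uv k by simp
      show "\<exists>a b. K = cbox a b"
        using uv k by (intro exI[of _ "c + u"] exI[of _ "c + v"]) simp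
      fix K' assume K': "K' \<in> ?D" "K \<noteq> K'"
      then obtain k' where k': "k' \<in> D" "K' = (+) c ` k'"
        by blast
      then have "interior k \<inter> interior k' = {}"
        using K' k division_ofD(5)[OF D(1)] by blast
      then show "interior K \<inter> interior K' = {}"
        unfolding k k' interior_translation by auto
    qed
    have inj: "inj_on ((`) ((+) c)) D"
      by (simp add: inj_on_def inj_image_eq_iff)
    have ends: "Sup ((+) c ` k) = c + Sup k" "Inf ((+) c ` k) = c + Inf k" if "k \<in> D" for k
    proof -
      from D(1) that obtain u v where "k = {u..v}" "u \<le> v" "Inf k = u" "Sup k = v"
        by (rule division_of_real_interval)
      then show "Sup ((+) c ` k) = c + Sup k" "Inf ((+) c ` k) = c + Inf k"
        by auto
    qed
    have "(\<Sum>k\<in>?D. Sup k - Inf k) = (\<Sum>k\<in>D. Sup k - Inf k)"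
      by (subst sum.reindex[OF inj]) (auto simp: ends intro!: sum.cong)
    moreover have "(\<Sum>k\<in>?D. norm (f (Sup k) - f (Inf k))) =
        (\<Sum>k\<in>D. norm (f (c + Sup k) - f (c + Inf k)))"
      by (subst sum.reindex[OF inj]) (auto simp: ends intro!: sum.cong)
    moreover have "(+) c ` U \<subseteq> (+) c ` I"
      using D(2) by blast
    ultimately show ?thesis
      using \<delta>(2)[rule_format, OF div] D(3) by simp
  qed
  then show "\<exists>\<delta>>0. \<forall>D U. D division_of U \<longrightarrow> U \<subseteq> I \<longrightarrow> (\<Sum>k\<in>D. Sup k - Inf k) < \<delta> \<longrightarrow>
      (\<Sum>k\<in>D. norm (f (c + Sup k) - f (c + Inf k))) < \<epsilon>"
    using \<delta>(1) by (intro exI[of _ \<delta>]) simp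
qed

text \<open>Members of a division lie left of \<open>c\<close>, right of \<open>c\<close>, or
  contain \<open>c\<close> in the interior. As members do not overlap, the last kind occurs at most
  once, and that member is cut at \<open>c\<close>. Hence the quarters: one for each side, two for
  the pieces of the cut member.\<close>

lemma absolutely_continuous_on_combine:
  fixes f :: "real \<Rightarrow> 'a::real_normed_vector"
  assumes "absolutely_continuous_on {a..c} f" "absolutely_continuous_on {c..b} f"
  shows "absolutely_continuous_on {a..b} f"
proof (rule absolutely_continuous_onI)
  fix \<epsilon> :: real assume "\<epsilon> > 0"
  then have e4: "\<epsilon> / 4 > 0" by simp
  obtain \<delta>1 where \<delta>1: "\<delta>1 > 0"
    "\<forall>D U. D division_of U \<longrightarrow> U \<subseteq> {a..c} \<longrightarrow> (\<Sum>k\<in>D. Sup k - Inf k) < \<delta>1 \<longrightarrow>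
        (\<Sum>k\<in>D. norm (f (Sup k) - f (Inf k))) < \<epsilon> / 4"
    "\<forall>u v. u \<le> v \<longrightarrow> {u..v} \<subseteq> {a..c} \<longrightarrow> v - u < \<delta>1 \<longrightarrow> norm (f v - f u) < \<epsilon> / 4"
    by (rule absolutely_continuous_onE[OF assms(1) e4])
  obtain \<delta>2 where \<delta>2: "\<delta>2 > 0"
    "\<forall>D U. D division_of U \<longrightarrow> U \<subseteq> {c..b} \<longrightarrow> (\<Sum>k\<in>D. Sup k - Inf k) < \<delta>2 \<longrightarrow>
        (\<Sum>k\<in>D. norm (f (Sup k) - f (Inf k))) < \<epsilon> / 4"
    "\<forall>u v. u \<le> v \<longrightarrow> {u..v} \<subseteq> {c..b} \<longrightarrow> v - u < \<delta>2 \<longrightarrow> norm (f v - f u) < \<epsilon> / 4"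
    by (rule absolutely_continuous_onE[OF assms(2) e4])
  have "(\<Sum>k\<in>D. norm (f (Sup k) - f (Inf k))) < \<epsilon>"
    if D: "D division_of U" "U \<subseteq> {a..b}" "(\<Sum>k\<in>D. Sup k - Inf k) < min \<delta>1 \<delta>2" for D U
  proof -
    let ?n = "\<lambda>k. norm (f (Sup k) - f (Inf k))"
    have fin: "finite D"
      using D(1) by (rule division_ofD)
    have DU: "D division_of \<Union>D"
      using D(1) division_ofD(6) by blast
    have nonneg: "0 \<le> Sup k - Inf k" if "k \<in> D" for k
      by (rule division_of_real_interval[OF D(1) that]) simp
    have short: "(\<Sum>k\<in>E. Sup k - Inf k) < min \<delta>1 \<delta>2" if "E \<subseteq> D" for E
      using sum_mono2[OF fin that, of "\<lambda>k. Sup k - Inf k"] nonneg D(3) by fastforce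
    have sub: "k \<subseteq> {a..b}" if "k \<in> D" for k
      using D that division_ofD(2) by blast
    define A B C where "A = {k \<in> D. Sup k \<le> c}" and "B = {k \<in> D. Sup k > c \<and> Inf k \<ge> c}"
      and "C = {k \<in> D. Sup k > c \<and> Inf k < c}"
    have split: "D = A \<union> (B \<union> C)" "A \<inter> (B \<union> C) = {}" "B \<inter> C = {}"
      by (auto simp: A_def B_def C_def)
    have finABC: "finite A" "finite B" "finite C"
      using fin by (auto simp: A_def B_def C_def)
    have "sum ?n A < \<epsilon> / 4"
    proof (rule \<delta>1(2)[rule_format])
      show "A division_of \<Union>A"
        using DU by (rule division_of_subset) (auto simp: A_def)
      show "\<Union>A \<subseteq> {a..c}"
      proof (rule Union_least)
        fix k assume k: "k \<in> A"
        then have "k \<in> D"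
          by (simp add: A_def)
        from D(1) this obtain u v where "k = {u..v}" "u \<le> v" "Inf k = u" "Sup k = v"
          by (rule division_of_real_interval)
        then show "k \<subseteq> {a..c}"
          using sub[of k] k by (auto simp: A_def)
      qed
      show "(\<Sum>k\<in>A. Sup k - Inf k) < \<delta>1"
        using short[of A] by (simp add: A_def)
    qed
    moreover have "sum ?n B < \<epsilon> / 4"
    proof (rule \<delta>2(2)[rule_format])
      show "B division_of \<Union>B"
        using DU by (rule division_of_subset) (auto simp: B_def)
      show "\<Union>B \<subseteq> {c..b}"
      proof (rule Union_least)
        fix k assume k: "k \<in> B"
        then have "k \<in> D"
          by (simp add: B_def)
        from D(1) this obtain u v where "k = {u..v}" "u \<le> v" "Inf k = u" "Sup k = v"
          by (rule division_of_real_interval)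
        then show "k \<subseteq> {c..b}"
          using sub[of k] k by (auto simp: B_def)
      qed
      show "(\<Sum>k\<in>B. Sup k - Inf k) < \<delta>2"
        using short[of B] by (simp add: B_def)
    qed
    moreover have "sum ?n C < \<epsilon> / 4 + \<epsilon> / 4"
    proof (cases "C = {}")
      case True
      then show ?thesis
        using \<open>\<epsilon> > 0\<close> by simp
    next
      case False
      then obtain k where k: "k \<in> C"
        by blast
      have int: "c \<in> interior k'" if k': "k' \<in> C" for k'
      proof -
        have "k' \<in> D"
          using k' by (simp add: C_def)
        from D(1) this obtain u v where "k' = {u..v}" "u \<le> v" "Inf k' = u" "Sup k' = v"
          by (rule division_of_real_interval)
        then show ?thesis
          using k' by (auto simp: C_def)
      qed
      have "k' = k" if "k' \<in> C" for k'
        using division_ofD(5)[OF D(1), of k' k] int[OF k] int[OF that] k that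
        by (auto simp: C_def)
      then have C: "C = {k}"
        using k by blast
      have "k \<in> D"
        using k by (simp add: C_def)
      from D(1) this obtain u v where uv: "k = {u..v}" "u \<le> v" "Inf k = u" "Sup k = v"
        by (rule division_of_real_interval)
      have kb: "a \<le> u" "v \<le> b" "u < c" "c < v"
        using k sub[of k] uv by (auto simp: C_def)
      have "v - u < min \<delta>1 \<delta>2"
        using short[of C] uv C by (auto simp: C_def)
      then have "norm (f v - f c) < \<epsilon> / 4"
        using kb by (intro \<delta>2(3)[rule_format]) auto
      moreover have "norm (f c - f u) < \<epsilon> / 4"
        using kb \<open>v - u < min \<delta>1 \<delta>2\<close> by (intro \<delta>1(3)[rule_format]) auto
      ultimately have "norm (f v - f u) < \<epsilon> / 4 + \<epsilon> / 4"
        using norm_triangle_ineq[of "f v - f c" "f c - f u"] by simp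
      then show ?thesis
        using C uv by simp
    qed
    moreover have "sum ?n D = sum ?n A + (sum ?n B + sum ?n C)"
      using split finABC by (simp add: sum.union_disjoint)
    ultimately show ?thesis
      by simp
  qed
  then show "\<exists>\<delta>>0. \<forall>D U. D division_of U \<longrightarrow> U \<subseteq> {a..b} \<longrightarrow> (\<Sum>k\<in>D. Sup k - Inf k) < \<delta> \<longrightarrow>
      (\<Sum>k\<in>D. norm (f (Sup k) - f (Inf k))) < \<epsilon>"
    using \<delta>1(1) \<delta>2(1) by (intro exI[of _ "min \<delta>1 \<delta>2"]) auto
qed

text \<open>A mean value inequality with an exceptional null set, by a gauge argument on a fine
  tagged division. Intervals tagged in \<open>N\<close> have small total length, so absolute
  continuity makes their increments small; at the other tags differentiability bounds each
  increment. Only a one-sided bound on \<open>inner \<zeta> v\<close> enters, so integrability of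
  the derivative never comes up.\<close>

lemma absolutely_continuous_increment_le:
  fixes f :: "real \<Rightarrow> 'a::real_inner"
  assumes ab: "a \<le> b" and ac: "absolutely_continuous_on {a..b} f" and N: "negligible N"
    and der: "\<And>t. t \<in> {a..b} - N \<Longrightarrow>
      \<exists>v. (f has_vector_derivative v) (at t within {a..b}) \<and> inner \<zeta> v \<le> c"
  shows "inner \<zeta> (f b - f a) \<le> c * (b - a)"
proof (rule field_le_epsilon)
  fix e :: real assume e: "e > 0"
  \<comment> \<open>The denominator lists the errors: \<open>norm \<zeta>\<close> from tags in
    \<open>N\<close>, \<open>norm \<zeta> * (b - a)\<close> from the derivative estimate,
    \<open>\<bar>c\<bar>\<close> from the length lost to \<open>N\<close> when \<open>c < 0\<close>;
    the 1 keeps it positive.\<close>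
  define \<epsilon> where "\<epsilon> = e / (norm \<zeta> * (b - a) + norm \<zeta> + \<bar>c\<bar> + 1)"
  have den: "norm \<zeta> * (b - a) + norm \<zeta> + \<bar>c\<bar> + 1 > 0"
    using ab by (smt (verit) mult_nonneg_nonneg norm_ge_zero)
  then have \<epsilon>: "\<epsilon> > 0"
    using e by (simp add: \<epsilon>_def)
  from ac \<epsilon> obtain \<delta> where \<delta>: "\<delta> > 0"
    "\<forall>D U. D division_of U \<longrightarrow> U \<subseteq> {a..b} \<longrightarrow> (\<Sum>k\<in>D. Sup k - Inf k) < \<delta> \<longrightarrow>
        (\<Sum>k\<in>D. norm (f (Sup k) - f (Inf k))) < \<epsilon>"
    "\<forall>u v. u \<le> v \<longrightarrow> {u..v} \<subseteq> {a..b} \<longrightarrow> v - u < \<delta> \<longrightarrow> norm (f v - f u) < \<epsilon>"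
    by (rule absolutely_continuous_onE)
  \<comment> \<open>The Riemann sums of this indicator measure the total length of the intervals
    tagged in \<open>N\<close>. They are made smaller than \<open>\<delta>\<close> for absolute
    continuity and smaller than \<open>\<epsilon>\<close> for the lost length.\<close>
  have "((indicator N :: real \<Rightarrow> real) has_integral 0) {a..b}"
    using N unfolding negligible_def box_real(2)[symmetric] by blast
  from this[unfolded has_integral_real, THEN spec[of _ "min \<delta> \<epsilon>"], THEN mp]
  have "\<exists>\<gamma>. gauge \<gamma> \<and> (\<forall>p. p tagged_division_of {a..b} \<and> \<gamma> fine p \<longrightarrow>
       norm ((\<Sum>(x,k)\<in>p. measure lborel k *\<^sub>R (indicator N x :: real)) - 0) < min \<delta> \<epsilon>)"
    using \<delta>(1) \<epsilon> by (meson min_less_iff_conj)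
  then obtain \<gamma> where \<gamma>: "gauge \<gamma>"
    "\<forall>p. p tagged_division_of {a..b} \<and> \<gamma> fine p \<longrightarrow>
       norm ((\<Sum>(x,k)\<in>p. measure lborel k *\<^sub>R (indicator N x :: real)) - 0) < min \<delta> \<epsilon>"
    by (elim exE conjE)
  \<comment> \<open>Requiring \<open>u \<le> t\<close> and \<open>t \<le> v\<close> makes the two
    one-sided errors add up to a multiple of \<open>v - u\<close>. The membership premise sits
    inside the claim so that a radius exists for every \<open>t\<close>, as a gauge demands.\<close>
  have "\<exists>d>0. \<forall>u v. t \<in> {a..b} - N \<longrightarrow> a \<le> u \<longrightarrow> u \<le> t \<longrightarrow> t \<le> v \<longrightarrow> v \<le> b \<longrightarrow> t - u < d \<longrightarrow> v - t < d \<longrightarrow>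
        inner \<zeta> (f v - f u) \<le> (c + norm \<zeta> * \<epsilon>) * (v - u)" for t
  proof (cases "t \<in> {a..b} - N")
    case False
    then show ?thesis by (intro exI[of _ 1]) auto
  next
    case True
    then obtain w where w: "(f has_vector_derivative w) (at t within {a..b})" "inner \<zeta> w \<le> c"
      using der by blast
    then obtain d where d: "d > 0" "\<And>y. y \<in> {a..b} \<Longrightarrow> norm (y - t) < d \<Longrightarrow>
        norm (f y - f t - (y - t) *\<^sub>R w) \<le> \<epsilon> * norm (y - t)"
      unfolding has_vector_derivative_def has_derivative_within_alt using \<epsilon> by blast
    have "inner \<zeta> (f v - f u) \<le> (c + norm \<zeta> * \<epsilon>) * (v - u)"
      if *: "a \<le> u" "u \<le> t" "t \<le> v" "v \<le> b" "t - u < d" "v - t < d" for u v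
    proof -
      have "norm (f v - f t - (v - t) *\<^sub>R w) \<le> \<epsilon> * (v - t)"
        using d(2)[of v] * by simp
      moreover have "norm (f u - f t - (u - t) *\<^sub>R w) \<le> \<epsilon> * (t - u)"
        using d(2)[of u] * by simp
      moreover have "f v - f u - (v - u) *\<^sub>R w =
          (f v - f t - (v - t) *\<^sub>R w) - (f u - f t - (u - t) *\<^sub>R w)"
        by (simp add: algebra_simps)
      ultimately have n: "norm (f v - f u - (v - u) *\<^sub>R w) \<le> \<epsilon> * (v - u)"
        using norm_triangle_ineq4[of "f v - f t - (v - t) *\<^sub>R w" "f u - f t - (u - t) *\<^sub>R w"]
        by (simp add: algebra_simps)
      have "inner \<zeta> (f v - f u) = inner \<zeta> (f v - f u - (v - u) *\<^sub>R w) + (v - u) * inner \<zeta> w"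
        by (simp add: inner_diff_right)
      also have "\<dots> \<le> norm \<zeta> * (\<epsilon> * (v - u)) + (v - u) * c"
      proof (rule add_mono)
        show "inner \<zeta> (f v - f u - (v - u) *\<^sub>R w) \<le> norm \<zeta> * (\<epsilon> * (v - u))"
          using n by (rule inner_le_norm_mult)
        show "(v - u) * inner \<zeta> w \<le> (v - u) * c"
          using w(2) * by (intro mult_left_mono) auto
      qed
      finally show ?thesis
        by (simp add: algebra_simps)
    qed
    then show ?thesis
      using d(1) by blast
  qed
  then obtain d where d: "\<And>t. d t > 0"
    "\<And>t u v. t \<in> {a..b} - N \<Longrightarrow> a \<le> u \<Longrightarrow> u \<le> t \<Longrightarrow> t \<le> v \<Longrightarrow> v \<le> b \<Longrightarrow> t - u < d t \<Longrightarrow> v - t < d t \<Longrightarrow>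
        inner \<zeta> (f v - f u) \<le> (c + norm \<zeta> * \<epsilon>) * (v - u)"
    by metis
  have "gauge (\<lambda>t. \<gamma> t \<inter> ball t (d t))"
    using \<gamma>(1) d(1) by (intro gauge_Int gauge_ball_dependent) auto
  then obtain p where p: "p tagged_division_of {a..b}" "(\<lambda>t. \<gamma> t \<inter> ball t (d t)) fine p"
    using fine_division_exists_real by blast
  have fine: "\<gamma> fine p" "(\<lambda>t. ball t (d t)) fine p"
    using p(2) unfolding fine_Int by blast+
  define p1 p2 where "p1 = {(x,k) \<in> p. x \<in> N}" and "p2 = {(x,k) \<in> p. x \<notin> N}"
  have p_sub: "p1 \<subseteq> p" "p2 \<subseteq> p"
    by (auto simp: p1_def p2_def)
  have fin: "finite p" "finite p1" "finite p2"
    using tagged_division_ofD(1)[OF p(1)] p_sub finite_subset by blast+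
  have p12: "p = p1 \<union> p2" "p1 \<inter> p2 = {}"
    by (auto simp: p1_def p2_def)
  have ivl: "\<exists>u v. k = {u..v} \<and> u \<le> x \<and> x \<le> v \<and> a \<le> u \<and> v \<le> b \<and> Inf k = u \<and> Sup k = v \<and> measure lborel k = v - u"
    if xk: "(x,k) \<in> p" for x k
  proof -
    obtain u v where k: "k = cbox u v"
      using tagged_division_ofD(4)[OF p(1) xk] by blast
    have "x \<in> k" "k \<subseteq> {a..b}"
      using tagged_division_ofD(2,3)[OF p(1) xk] by auto
    then show ?thesis
      unfolding k by (intro exI[of _ u] exI[of _ v]) simp
  qed
  have total: "(\<Sum>(x,k)\<in>p. Sup k - Inf k) = b - a"
    using additive_tagged_division_1[OF ab p(1), of "\<lambda>t. t"] .
  have len1: "(\<Sum>(x,k)\<in>p1. Sup k - Inf k) < min \<delta> \<epsilon>"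
  proof -
    have "(\<Sum>(x,k)\<in>p. measure lborel k *\<^sub>R (indicator N x :: real)) =
      (\<Sum>(x,k)\<in>p1. measure lborel k *\<^sub>R (indicator N x :: real))"
      using fin by (intro sum.mono_neutral_right) (auto simp: p1_def indicator_def)
    also have "\<dots> = (\<Sum>(x,k)\<in>p1. Sup k - Inf k)"
    proof (rule sum.cong[OF refl], clarify)
      fix x k assume "(x,k) \<in> p1"
      then show "measure lborel k *\<^sub>R (indicator N x :: real) = Sup k - Inf k"
        using ivl[of x k] by (auto simp: p1_def)
    qed
    finally show ?thesis
      using \<gamma>(2)[rule_format, of p] p(1) fine(1) by (simp add: abs_less_iff)
  qed
  have len1_nonneg: "0 \<le> (\<Sum>(x,k)\<in>p1. Sup k - Inf k)"
  proof (rule sum_nonneg, clarify)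
    fix x k assume "(x,k) \<in> p1"
    then show "0 \<le> Sup k - Inf k"
      using ivl[of x k] by (auto simp: p1_def)
  qed
  have sum1: "(\<Sum>(x,k)\<in>p1. norm (f (Sup k) - f (Inf k))) < \<epsilon>"
  proof -
    have part: "p1 tagged_partial_division_of {a..b}"
      using p(1) unfolding tagged_division_of_def p1_def
      by (rule tagged_partial_division_subset[OF conjunct1]) auto
    have tag: "p1 tagged_division_of \<Union>(snd ` p1)"
      using part by (rule tagged_partial_division_of_Union_self)
    have div: "snd ` p1 division_of \<Union>(snd ` p1)"
      using tag by (rule division_of_tagged_division)
    have reindex: "(\<Sum>k\<in>snd ` p1. g k) = (\<Sum>(x,k)\<in>p1. g k)" if g: "\<And>t. g {t} = 0"
      for g :: "real set \<Rightarrow> real"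
    proof -
      \<comment> \<open>The reindexing lemma asks for the value 0 on every box with empty interior,
        including the empty box, where \<open>Sup\<close> and \<open>Inf\<close> carry no
        information; hence the change at \<open>{}\<close>. Degenerate intervals, which may occur
        under several tags, contribute 0.\<close>
      define h where "h k = (if k = {} then 0 else g k)" for k
      have "h (cbox u v) = 0" if "box u v = {}" for u v
        using that g by (cases "u = v") (auto simp: h_def)
      then have "(\<Sum>(x,k)\<in>p1. h k) = (\<Sum>k\<in>snd ` p1. h k)"
        by (rule sum.over_tagged_division_lemma[OF tag])
      moreover have "h k = g k" if "k \<in> snd ` p1" for k
        using division_ofD(3)[OF div that] by (simp add: h_def)
      ultimately show ?thesis
        by (simp add: case_prod_unfold)
    qed
    have "(\<Sum>k\<in>snd ` p1. Sup k - Inf k) = (\<Sum>(x,k)\<in>p1. Sup k - Inf k)"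
      by (rule reindex) simp
    moreover have "(\<Sum>k\<in>snd ` p1. norm (f (Sup k) - f (Inf k))) =
        (\<Sum>(x,k)\<in>p1. norm (f (Sup k) - f (Inf k)))"
      by (rule reindex) simp
    moreover have "\<Union>(snd ` p1) \<subseteq> {a..b}"
      using tagged_division_ofD(3)[OF p(1)] p_sub(1) by fastforce
    ultimately show ?thesis
      using \<delta>(2)[rule_format, OF div] len1 by simp
  qed
  have part1: "(\<Sum>(x,k)\<in>p1. inner \<zeta> (f (Sup k) - f (Inf k))) \<le> norm \<zeta> * \<epsilon>"
  proof -
    have "(\<Sum>(x,k)\<in>p1. inner \<zeta> (f (Sup k) - f (Inf k))) \<le>
        (\<Sum>(x,k)\<in>p1. norm \<zeta> * norm (f (Sup k) - f (Inf k)))"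
      by (intro sum_mono) (simp add: norm_cauchy_schwarz case_prod_unfold)
    also have "\<dots> = norm \<zeta> * (\<Sum>(x,k)\<in>p1. norm (f (Sup k) - f (Inf k)))"
      by (simp add: sum_distrib_left case_prod_unfold)
    also have "\<dots> \<le> norm \<zeta> * \<epsilon>"
      using sum1 by (intro mult_left_mono) auto
    finally show ?thesis .
  qed
  have part2: "(\<Sum>(x,k)\<in>p2. inner \<zeta> (f (Sup k) - f (Inf k))) \<le>
      (c + norm \<zeta> * \<epsilon>) * (\<Sum>(x,k)\<in>p2. Sup k - Inf k)"
  proof -
    have "(\<Sum>(x,k)\<in>p2. inner \<zeta> (f (Sup k) - f (Inf k))) \<le>
        (\<Sum>(x,k)\<in>p2. (c + norm \<zeta> * \<epsilon>) * (Sup k - Inf k))"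
    proof (rule sum_mono, clarify)
      fix x k assume "(x,k) \<in> p2"
      then have xk: "(x,k) \<in> p" "x \<notin> N"
        by (auto simp: p2_def)
      obtain u v where uv: "k = {u..v}" "u \<le> x" "x \<le> v" "a \<le> u" "v \<le> b" "Inf k = u" "Sup k = v"
        using ivl[OF xk(1)] by auto
      have "{u..v} \<subseteq> ball x (d x)"
        using fine(2) xk(1) uv(1) by (auto simp: fine_def)
      moreover have "u \<in> {u..v}" "v \<in> {u..v}"
        using uv by auto
      ultimately have "u \<in> ball x (d x)" "v \<in> ball x (d x)"
        by blast+
      then show "inner \<zeta> (f (Sup k) - f (Inf k)) \<le> (c + norm \<zeta> * \<epsilon>) * (Sup k - Inf k)"
        using d(2)[of x u v] uv xk by (auto simp: dist_real_def)
    qed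
    then show ?thesis
      by (simp add: sum_distrib_left case_prod_unfold)
  qed
  have "inner \<zeta> (f b - f a) = (\<Sum>(x,k)\<in>p. inner \<zeta> (f (Sup k) - f (Inf k)))"
    using additive_tagged_division_1[OF ab p(1), of "\<lambda>t. inner \<zeta> (f t)"]
    by (simp add: inner_diff_right)
  also have "\<dots> = (\<Sum>(x,k)\<in>p1. inner \<zeta> (f (Sup k) - f (Inf k))) +
      (\<Sum>(x,k)\<in>p2. inner \<zeta> (f (Sup k) - f (Inf k)))"
    unfolding p12(1) by (rule sum.union_disjoint[OF fin(2,3) p12(2)])
  also have "\<dots> \<le> norm \<zeta> * \<epsilon> + (c + norm \<zeta> * \<epsilon>) * (b - a - (\<Sum>(x,k)\<in>p1. Sup k - Inf k))"
  proof -
    have "(\<Sum>(x,k)\<in>p2. Sup k - Inf k) = b - a - (\<Sum>(x,k)\<in>p1. Sup k - Inf k)"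
      using total unfolding p12(1) sum.union_disjoint[OF fin(2,3) p12(2)] by simp
    then show ?thesis
      using part1 part2 by simp
  qed
  also have "\<dots> \<le> norm \<zeta> * \<epsilon> + c * (b - a) + norm \<zeta> * \<epsilon> * (b - a) + \<bar>c\<bar> * \<epsilon>"
  proof -
    let ?s = "\<Sum>(x,k)\<in>p1. Sup k - Inf k"
    have "- (c * ?s) \<le> \<bar>c\<bar> * ?s"
      using len1_nonneg by (metis abs_ge_minus_self minus_mult_left mult_right_mono)
    also have "\<dots> \<le> \<bar>c\<bar> * \<epsilon>"
      using len1 by (intro mult_left_mono) auto
    finally have "- (c * ?s) \<le> \<bar>c\<bar> * \<epsilon>" .
    moreover have "0 \<le> norm \<zeta> * \<epsilon> * ?s"
      using \<epsilon> len1_nonneg by simp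
    ultimately show ?thesis
      by (simp add: algebra_simps)
  qed
  also have "\<dots> \<le> c * (b - a) + e"
  proof -
    have "norm \<zeta> * \<epsilon> + norm \<zeta> * \<epsilon> * (b - a) + \<bar>c\<bar> * \<epsilon> + \<epsilon> =
        \<epsilon> * (norm \<zeta> * (b - a) + norm \<zeta> + \<bar>c\<bar> + 1)"
      by (simp add: algebra_simps)
    also have "\<dots> = e"
      using den by (simp add: \<epsilon>_def)
    finally show ?thesis
      using \<epsilon> by simp
  qed
  finally show "inner \<zeta> (f b - f a) \<le> c * (b - a) + e" .
qed

subsection \<open>Trajectories and minimal time\<close>

text \<open>An explicit negligible set matches the mean value inequality and can be translated,
  enlarged and united directly.\<close>

lemma trajectory_on_iff:
  "trajectory_on F {a..b} x \<longleftrightarrow> absolutely_continuous_on {a..b} x \<and>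
     (\<exists>N. negligible N \<and>
       (\<forall>t\<in>{a..b} - N. \<exists>v\<in>F (x t). (x has_vector_derivative v) (at t within {a..b})))"
proof -
  have "(AE t in lebesgue_on {a..b}. P t) \<longleftrightarrow> (\<exists>N. negligible N \<and> (\<forall>t\<in>{a..b} - N. P t))" for P
  proof -
    have "(AE t in lebesgue_on {a..b}. P t) \<longleftrightarrow> (AE t in lebesgue. t \<in> {a..b} \<longrightarrow> P t)"
      by (subst AE_restrict_space_iff) auto
    also have "\<dots> \<longleftrightarrow> (\<exists>N. negligible N \<and> (\<forall>t\<in>{a..b} - N. P t))"
    proof
      assume "AE t in lebesgue. t \<in> {a..b} \<longrightarrow> P t"
      then obtain N where "N \<in> null_sets lebesgue" "{t \<in> space lebesgue. \<not> (t \<in> {a..b} \<longrightarrow> P t)} \<subseteq> N"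
        unfolding eventually_ae_filter by blast
      then show "\<exists>N. negligible N \<and> (\<forall>t\<in>{a..b} - N. P t)"
        unfolding negligible_iff_null_sets by (intro exI[of _ N]) auto
    next
      assume "\<exists>N. negligible N \<and> (\<forall>t\<in>{a..b} - N. P t)"
      then obtain N where N: "negligible N" "\<forall>t\<in>{a..b} - N. P t"
        by blast
      show "AE t in lebesgue. t \<in> {a..b} \<longrightarrow> P t"
        by (rule AE_I'[of N]) (use N in \<open>auto simp: negligible_iff_null_sets\<close>)
    qed
    finally show ?thesis .
  qed
  then show ?thesis
    unfolding trajectory_on_def by simp
qed

lemma trajectory_on_subset:
  assumes "trajectory_on F {a..b} x" "{c..d} \<subseteq> {a..b}"
  shows "trajectory_on F {c..d} x"
proof -
  obtain N where N: "negligible N"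
    "\<And>t. t \<in> {a..b} - N \<Longrightarrow> \<exists>v\<in>F (x t). (x has_vector_derivative v) (at t within {a..b})"
    using assms(1) unfolding trajectory_on_iff by blast
  have "\<exists>v\<in>F (x t). (x has_vector_derivative v) (at t within {c..d})" if "t \<in> {c..d} - N" for t
    using N(2)[of t] that assms(2) has_vector_derivative_within_subset by blast
  moreover have "absolutely_continuous_on {c..d} x"
    using assms absolutely_continuous_on_subset_cong[of "{a..b}" x "{c..d}" x]
    by (simp add: trajectory_on_iff)
  ultimately show ?thesis
    using N(1) unfolding trajectory_on_iff by blast
qed

lemma trajectory_on_shift:
  fixes x :: "real \<Rightarrow> 'a::euclidean_space"
  assumes "trajectory_on F {c + a..c + b} x"
  shows "trajectory_on F {a..b} (\<lambda>t. x (c + t))"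
proof -
  have ac: "absolutely_continuous_on {c + a..c + b} x"
    using assms trajectory_on_iff by blast
  obtain N where N: "negligible N"
    "\<And>t. t \<in> {c + a..c + b} - N \<Longrightarrow> \<exists>v\<in>F (x t). (x has_vector_derivative v) (at t within {c + a..c + b})"
    using assms unfolding trajectory_on_iff by blast
  have img: "(+) c ` {a..b} = {c + a..c + b}"
    by simp
  have "absolutely_continuous_on {a..b} (\<lambda>t. x (c + t))"
    using ac by (intro absolutely_continuous_on_shift) (simp only: img)
  moreover have "negligible ((+) (- c) ` N)"
    using N(1) by (rule negligible_translation)
  moreover have "\<exists>v\<in>F (x (c + t)). ((\<lambda>t. x (c + t)) has_vector_derivative v) (at t within {a..b})"
    if "t \<in> {a..b} - (+) (- c) ` N" for t
  proof -
    have "c + t \<in> {c + a..c + b} - N"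
      using that by force
    then obtain v where v: "v \<in> F (x (c + t))"
      "(x has_vector_derivative v) (at (c + t) within (+) c ` {a..b})"
      using N(2) unfolding img by blast
    have "((+) c has_vector_derivative 1) (at t within {a..b})"
      by (auto intro!: derivative_eq_intros)
    from vector_diff_chain_within[OF this v(2)]
    show ?thesis
      using v(1) by (auto simp: o_def)
  qed
  ultimately show ?thesis
    unfolding trajectory_on_iff by blast
qed

lemma trajectory_on_combine:
  fixes x :: "real \<Rightarrow> 'a::euclidean_space"
  assumes "trajectory_on F {a..c} x" "trajectory_on F {c..b} x" "a \<le> c" "c \<le> b"
  shows "trajectory_on F {a..b} x"
proof -
  obtain N1 where N1: "negligible N1"
    "\<And>t. t \<in> {a..c} - N1 \<Longrightarrow> \<exists>v\<in>F (x t). (x has_vector_derivative v) (at t within {a..c})"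
    using assms(1) unfolding trajectory_on_iff by blast
  obtain N2 where N2: "negligible N2"
    "\<And>t. t \<in> {c..b} - N2 \<Longrightarrow> \<exists>v\<in>F (x t). (x has_vector_derivative v) (at t within {c..b})"
    using assms(2) unfolding trajectory_on_iff by blast
  have "absolutely_continuous_on {a..b} x"
    using assms trajectory_on_iff by (blast intro: absolutely_continuous_on_combine)
  \<comment> \<open>\<open>c\<close> joins the exceptional set because the one-sided derivatives of
    the two pieces need not agree there.\<close>
  moreover have "negligible (N1 \<union> N2 \<union> {c})"
    using N1 N2 by (intro negligible_Un) auto
  moreover have "\<exists>v\<in>F (x t). (x has_vector_derivative v) (at t within {a..b})"
    if t: "t \<in> {a..b} - (N1 \<union> N2 \<union> {c})" for t
  proof (cases "t < c")
    case True
    then have "at t within {a..b} = at t within {a..c}"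
      using assms by (intro at_within_nhd[of _ "{..<c}"]) auto
    then show ?thesis
      using N1(2)[of t] t True by auto
  next
    case False
    then have "at t within {a..b} = at t within {c..b}"
      using assms t by (intro at_within_nhd[of _ "{c<..}"]) auto
    then show ?thesis
      using N2(2)[of t] t False by auto
  qed
  ultimately show ?thesis
    unfolding trajectory_on_iff by blast
qed

lemma trajectory_on_cong:
  fixes x :: "real \<Rightarrow> 'a::euclidean_space"
  assumes "trajectory_on F {a..b} x" "\<And>t. t \<in> {a..b} \<Longrightarrow> x t = y t"
  shows "trajectory_on F {a..b} y"
proof -
  have "absolutely_continuous_on {a..b} y"
    using assms absolutely_continuous_on_subset_cong[of "{a..b}" x "{a..b}" y]
    by (simp add: trajectory_on_iff)
  moreover obtain N where N: "negligible N"
    "\<And>t. t \<in> {a..b} - N \<Longrightarrow> \<exists>v\<in>F (x t). (x has_vector_derivative v) (at t within {a..b})"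
    using assms(1) unfolding trajectory_on_iff by blast
  moreover have "\<exists>v\<in>F (y t). (y has_vector_derivative v) (at t within {a..b})"
    if t: "t \<in> {a..b} - N" for t
  proof -
    obtain v where v: "v \<in> F (x t)" "(x has_vector_derivative v) (at t within {a..b})"
      using N(2)[OF t] by blast
    have "(y has_vector_derivative v) (at t within {a..b})"
      by (rule has_vector_derivative_transform[OF _ _ v(2)]) (use t assms(2) in auto)
    then show ?thesis
      using v(1) assms(2)[of t] t by auto
  qed
  ultimately show ?thesis
    unfolding trajectory_on_iff by blast
qed

section \<open>Minimal time under restriction and concatenation of trajectories\<close>

lemma min_time_le:
  assumes "trajectory_on F {0..\<tau>} x" "0 \<le> \<tau>" "x 0 = p" "x \<tau> = q"
  shows "min_time F (p, q) \<le> ereal \<tau>"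
  using assms unfolding min_time_def by (auto intro!: Inf_lower)

lemma min_time_nonneg: "0 \<le> min_time F p"
  unfolding min_time_def by (cases p) (auto intro!: Inf_greatest)

lemma min_time_leE:
  assumes "min_time F (p, q) \<le> ereal t" "e > 0"
  obtains \<tau> x where "0 \<le> \<tau>" "\<tau> \<le> t + e" "trajectory_on F {0..\<tau>} x" "x 0 = p" "x \<tau> = q"
proof -
  have "min_time F (p, q) < ereal (t + e)"
    using assms by (simp add: order_le_less_trans)
  then show ?thesis
    unfolding min_time_def using that by (auto simp: Inf_less_iff)
qed

text \<open>Concatenate \<open>z\<close> with a trajectory from \<open>p\<close> of duration at most
  \<open>t + e\<close>, then let \<open>e\<close> tend to 0; the resulting bound carries no
  slack.\<close>

lemma min_time_prepend:
  fixes z :: "real \<Rightarrow> 'a::euclidean_space"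
  assumes "min_time F (p, q) \<le> ereal t" "trajectory_on F {0..s} z" "0 \<le> s" "z s = p"
  shows "min_time F (z 0, q) \<le> ereal (t + s)"
proof (rule ereal_le_epsilon2)
  fix e :: real assume "e > 0"
  from assms(1) this
  obtain \<tau> x where x: "0 \<le> \<tau>" "\<tau> \<le> t + e" "trajectory_on F {0..\<tau>} x" "x 0 = p" "x \<tau> = q"
    by (rule min_time_leE)
  \<comment> \<open>The branches agree at the junction, where \<open>z s = p\<close> and
    \<open>x 0 = p\<close>.\<close>
  define y where "y r = (if r \<le> s then z r else x (- s + r))" for r
  have "trajectory_on F {s..s + \<tau>} (\<lambda>r. x (- s + r))"
    using x by (intro trajectory_on_shift) simp
  then have "trajectory_on F {s..s + \<tau>} y"
    by (rule trajectory_on_cong) (use assms x in \<open>auto simp: y_def\<close>)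
  moreover have "trajectory_on F {0..s} y"
    using assms(2) by (rule trajectory_on_cong) (auto simp: y_def)
  ultimately have "trajectory_on F {0..s + \<tau>} y"
    using x assms by (intro trajectory_on_combine[of F 0 s y "s + \<tau>"]) auto
  then have "min_time F (z 0, q) \<le> ereal (s + \<tau>)"
    by (rule min_time_le) (use x assms in \<open>auto simp: y_def\<close>)
  also have "\<dots> \<le> ereal (t + s) + ereal e"
    using x by simp
  finally show "min_time F (z 0, q) \<le> ereal (t + s) + ereal e" .
qed

lemma min_time_along_trajectory:
  fixes x :: "real \<Rightarrow> 'a::euclidean_space"
  assumes "trajectory_on F {0..\<tau>} x" "0 \<le> r" "r \<le> \<tau>"
  shows "min_time F (x r, x \<tau>) \<le> ereal (\<tau> - r)"
proof -
  have "trajectory_on F {r + 0..r + (\<tau> - r)} x"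
    using assms by (intro trajectory_on_subset[OF assms(1)]) auto
  then have "trajectory_on F {0..\<tau> - r} (\<lambda>t. x (r + t))"
    by (rule trajectory_on_shift)
  then show ?thesis
    by (rule min_time_le) (use assms in auto)
qed

subsection \<open>Lipschitz differential inclusions\<close>

text \<open>Projection depends on the convex set with Hoelder exponent 1/2 in the Hausdorff
  distance. Each variational inequality speaks of points of its own set only, so it is tested at a
  \<open>\<delta>\<close>-close substitute for the other projection. The substitutions cost a term
  of order \<open>\<delta>\<close>, while the left side is a square.\<close>

lemma closest_point_hausdorff:
  fixes p :: "'a::euclidean_space"
  assumes C: "convex C" "closed C" "C \<noteq> {}" and D: "convex D" "closed D" "D \<noteq> {}"
    and CD: "\<And>u. u \<in> C \<Longrightarrow> \<exists>w\<in>D. norm (u - w) \<le> \<delta>"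
    and DC: "\<And>u. u \<in> D \<Longrightarrow> \<exists>w\<in>C. norm (u - w) \<le> \<delta>"
  shows "(norm (closest_point C p - closest_point D p))\<^sup>2 \<le> \<delta> * (2 * norm (p - closest_point C p) + \<delta>)"
proof -
  define a b where "a = closest_point C p" and "b = closest_point D p"
  have a: "a \<in> C" and b: "b \<in> D"
    using C D closest_point_in_set unfolding a_def b_def by blast+
  obtain a' where a': "a' \<in> D" "norm (a - a') \<le> \<delta>"
    using CD a by blast
  obtain b' where b': "b' \<in> C" "norm (b - b') \<le> \<delta>"
    using DC b by blast
  have "inner (p - a) (b' - a) \<le> 0"
    using closest_point_dot[OF C(1,2) b'(1)] by (simp add: a_def)
  moreover have "inner (p - b) (a' - b) \<le> 0"
    using closest_point_dot[OF D(1,2) a'(1)] by (simp add: b_def)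
  moreover have "inner (p - a) (b - b') \<le> norm (p - a) * \<delta>"
    using b'(2) by (rule inner_le_norm_mult)
  moreover have "inner (p - b) (a - a') \<le> norm (p - b) * \<delta>"
    using a'(2) by (rule inner_le_norm_mult)
  \<comment> \<open>A regrouping of \<open>inner ((p - b) - (p - a)) (a - b)\<close>.\<close>
  moreover have "(norm (a - b))\<^sup>2 = inner (p - a) (b' - a) + inner (p - a) (b - b')
      + inner (p - b) (a' - b) + inner (p - b) (a - a')"
    by (simp add: power2_norm_eq_inner algebra_simps inner_commute)
  ultimately have "(norm (a - b))\<^sup>2 \<le> \<delta> * (norm (p - a) + norm (p - b))"
    by (simp add: algebra_simps)
  also have "norm (p - b) \<le> norm (p - a) + \<delta>"
  proof -
    have "norm (p - b) \<le> norm (p - a')"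
      using closest_point_le[OF D(2) a'(1), of p] by (simp add: b_def dist_norm)
    also have "\<dots> \<le> norm (p - a) + norm (a - a')"
      using norm_triangle_ineq[of "p - a" "a - a'"] by simp
    finally show ?thesis
      using a'(2) by simp
  qed
  then have "\<delta> * (norm (p - a) + norm (p - b)) \<le> \<delta> * (2 * norm (p - a) + \<delta>)"
    using a'(2) norm_ge_zero[of "a - a'"] by (intro mult_left_mono) linarith+
  finally show ?thesis
    by (simp add: a_def b_def)
qed

text \<open>A change of the set is controlled by the Hausdorff estimate, a change of the point by
  nonexpansiveness. Continuity of projected velocities lets the iteration below run with continuous
  functions, without measurable selections.\<close>

lemma continuous_on_closest_point_lipschitz:
  fixes G :: "'a::euclidean_space \<Rightarrow> 'a set"
  assumes G: "\<And>x. convex (G x)" "\<And>x. closed (G x)" "\<And>x. G x \<noteq> {}"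
    and L: "\<And>x y u. u \<in> G x \<Longrightarrow> \<exists>w\<in>G y. norm (u - w) \<le> L * norm (x - y)"
    and cont: "continuous_on I x" "continuous_on I v"
  shows "continuous_on I (\<lambda>t. closest_point (G (x t)) (v t))"
  unfolding continuous_on_def
proof
  fix t assume t: "t \<in> I"
  let ?c = "\<lambda>s p. closest_point (G (x s)) p"
  let ?\<delta> = "\<lambda>s. L * norm (x t - x s)"
  let ?b = "\<lambda>s. sqrt (?\<delta> s * (2 * norm (v t - ?c t (v t)) + ?\<delta> s)) + norm (v s - v t)"
  have "((\<lambda>s. x s) \<longlongrightarrow> x t) (at t within I)" "((\<lambda>s. v s) \<longlongrightarrow> v t) (at t within I)"
    using cont t by (auto simp: continuous_on_def)
  then have "(?b \<longlongrightarrow> sqrt (L * norm (x t - x t) * (2 * norm (v t - ?c t (v t)) + L * norm (x t - x t)))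
      + norm (v t - v t)) (at t within I)"
    by (intro tendsto_intros)
  then have lim: "(?b \<longlongrightarrow> 0) (at t within I)"
    by simp
  have bound: "norm (?c s (v s) - ?c t (v t)) \<le> ?b s" for s
  proof -
    have "(norm (?c t (v t) - ?c s (v t)))\<^sup>2 \<le> ?\<delta> s * (2 * norm (v t - ?c t (v t)) + ?\<delta> s)"
    proof (rule closest_point_hausdorff[OF G G])
      show "\<exists>w\<in>G (x s). norm (u - w) \<le> ?\<delta> s" if "u \<in> G (x t)" for u
        using L[OF that] .
      show "\<exists>w\<in>G (x t). norm (u - w) \<le> ?\<delta> s" if "u \<in> G (x s)" for u
        using L[OF that, of "x t"] by (simp add: norm_minus_commute)
    qed
    then have "norm (?c t (v t) - ?c s (v t)) \<le> sqrt (?\<delta> s * (2 * norm (v t - ?c t (v t)) + ?\<delta> s))"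
      by (rule real_le_rsqrt)
    moreover have "norm (?c s (v s) - ?c s (v t)) \<le> norm (v s - v t)"
      using closest_point_lipschitz[OF G(1-3)] by (simp add: dist_norm)
    ultimately show ?thesis
      using norm_triangle_ineq4[of "?c s (v s) - ?c s (v t)" "?c t (v t) - ?c s (v t)"]
      by simp
  qed
  have "((\<lambda>s. ?c s (v s) - ?c t (v t)) \<longlongrightarrow> 0) (at t within I)"
    by (rule Lim_null_comparison[OF _ lim]) (simp add: bound)
  then show "((\<lambda>s. ?c s (v s)) \<longlongrightarrow> ?c t (v t)) (at t within I)"
    by (rule LIM_zero_cancel)
qed

lemma norm_integral_le:
  fixes f :: "real \<Rightarrow> 'a::euclidean_space"
  assumes "continuous_on {0..s} f" "\<And>t. t \<in> {0..s} \<Longrightarrow> norm (f t) \<le> B" "t \<in> {0..s}" "0 \<le> B"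
  shows "norm (integral {t..s} f) \<le> B * s"
proof -
  have "norm (integral {t..s} f) \<le> B * (s - t)"
    using assms by (intro integral_bound continuous_on_subset[OF assms(1)]) auto
  also have "\<dots> \<le> B * s"
    using assms by (intro mult_left_mono) auto
  finally show ?thesis .
qed

text \<open>
  Filippov's construction: the velocity of each Picard iterate is the projection of the previous
  velocity onto the values of \<open>G\<close> along the previous iterate.
\<close>
lemma lipschitz_inclusion_backward_solution:
  fixes G :: "'a::euclidean_space \<Rightarrow> 'a set"
  assumes G: "\<And>x. convex (G x)" "\<And>x. closed (G x)" "\<And>x. G x \<noteq> {}"
    and L: "\<And>x y u. u \<in> G x \<Longrightarrow> \<exists>w\<in>G y. norm (u - w) \<le> L * norm (x - y)"
    and L0: "0 \<le> L" and s: "0 \<le> s" "L * s \<le> 1 / 2" and v0: "v0 \<in> G \<alpha>"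
  obtains w where "continuous_on {0..s} w"
    "\<And>t. t \<in> {0..s} \<Longrightarrow> w t \<in> G (x - integral {t..s} w)"
    "\<And>t. t \<in> {0..s} \<Longrightarrow> norm (w t - v0) \<le> 2 * L * (norm (x - \<alpha>) + s * norm v0)"
proof -
  \<comment> \<open>The curve with velocity \<open>v\<close> and prescribed terminal value
    \<open>x\<close> at time \<open>s\<close>; the integral therefore runs from \<open>t\<close> to
    \<open>s\<close>.\<close>
  define P where "P v t = x - integral {t..s} v" for v :: "real \<Rightarrow> 'a" and t
  define V where "V = rec_nat (\<lambda>_. v0) (\<lambda>_ v t. closest_point (G (P v t)) (v t))"
  have V0: "V 0 = (\<lambda>_. v0)" and VSuc: "V (Suc i) = (\<lambda>t. closest_point (G (P (V i) t)) (V i t))" for i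
    by (simp_all add: V_def)
  \<comment> \<open>A bound for the first correction: the straight curve \<open>P (V 0)\<close>
    stays within \<open>norm (x - \<alpha>) + s * norm v0\<close> of \<open>\<alpha>\<close>, where
    \<open>v0\<close> is admissible. The geometric series of all corrections then sums to
    \<open>2 * B\<close>.\<close>
  define B where "B = L * (norm (x - \<alpha>) + s * norm v0)"
  have B0: "0 \<le> B"
    using L0 s by (simp add: B_def)
  have contP: "continuous_on {0..s} (P v)" if "continuous_on {0..s} v" for v
    unfolding P_def using that
    by (intro continuous_intros indefinite_integral_continuous_1' integrable_continuous_real)
  have contV: "continuous_on {0..s} (V i)" for i
  proof (induction i)
    case 0
    show ?case by (simp add: V0)
  next
    case (Suc i)
    then show ?case
      unfolding VSuc by (intro continuous_on_closest_point_lipschitz[OF G L] contP)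
  qed
  have inG: "V (Suc i) t \<in> G (P (V i) t)" for i t
    using closest_point_in_set[OF G(2,3)] by (simp add: VSuc)
  have diffP: "norm (P v t - P w t) \<le> s * C"
    if "continuous_on {0..s} v" "continuous_on {0..s} w" "t \<in> {0..s}" "0 \<le> C"
      "\<And>t. t \<in> {0..s} \<Longrightarrow> norm (w t - v t) \<le> C" for v w t C
  proof -
    have int: "v integrable_on {t..s}" "w integrable_on {t..s}"
      using that by (auto intro!: integrable_continuous_real intro: continuous_on_subset)
    have "P v t - P w t = integral {t..s} (\<lambda>r. w r - v r)"
      using int by (simp add: P_def integral_diff)
    then show ?thesis
      using norm_integral_le[of s "\<lambda>r. w r - v r" C t] that
      by (simp add: continuous_on_diff mult.commute)
  qed
  \<comment> \<open>One iteration multiplies the distance of velocities by \<open>s\<close> through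
    integration and by \<open>L\<close> through the Lipschitz property;
    \<open>L * s \<le> 1 / 2\<close> gives the ratio 1/2.\<close>
  have step: "\<forall>t\<in>{0..s}. norm (V (Suc i) t - V i t) \<le> B * (1/2)^i" for i
  proof (induction i)
    case 0
    show ?case
    proof
      fix t assume t: "t \<in> {0..s}"
      have Pt: "P (V 0) t = x - (s - t) *\<^sub>R v0"
        using t by (simp add: P_def V0)
      obtain w where w: "w \<in> G (P (V 0) t)" "norm (v0 - w) \<le> L * norm (\<alpha> - P (V 0) t)"
        using L[OF v0] by blast
      have "norm (V 1 t - V 0 t) \<le> norm (v0 - w)"
        using closest_point_le[OF G(2) w(1), of v0]
        by (simp add: VSuc V0 dist_norm norm_minus_commute)
      also have "\<dots> \<le> L * norm (\<alpha> - P (V 0) t)"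
        by (rule w)
      also have "\<dots> \<le> B"
        unfolding B_def
      proof (rule mult_left_mono[OF _ L0])
        have "norm (\<alpha> - P (V 0) t) \<le> norm (\<alpha> - x) + norm ((s - t) *\<^sub>R v0)"
          unfolding Pt using norm_triangle_ineq[of "\<alpha> - x" "(s - t) *\<^sub>R v0"] by (simp add: algebra_simps)
        also have "norm ((s - t) *\<^sub>R v0) \<le> s * norm v0"
          using t by (auto intro: mult_right_mono)
        finally show "norm (\<alpha> - P (V 0) t) \<le> norm (x - \<alpha>) + s * norm v0"
          by (simp add: norm_minus_commute)
      qed
      finally show "norm (V (Suc 0) t - V 0 t) \<le> B * (1/2)^0"
        by simp
    qed
  next
    case (Suc i)
    show ?case
    proof
      fix t assume t: "t \<in> {0..s}"
      obtain w where w: "w \<in> G (P (V (Suc i)) t)"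
        "norm (V (Suc i) t - w) \<le> L * norm (P (V i) t - P (V (Suc i)) t)"
        using L[OF inG] by blast
      have "norm (V (Suc (Suc i)) t - V (Suc i) t) \<le> norm (V (Suc i) t - w)"
        using closest_point_le[OF G(2) w(1), of "V (Suc i) t"]
        by (simp add: VSuc[of "Suc i"] dist_norm norm_minus_commute)
      also have "\<dots> \<le> L * norm (P (V i) t - P (V (Suc i)) t)"
        by (rule w)
      also have "\<dots> \<le> L * (s * (B * (1/2)^i))"
        using Suc B0 t L0 contV by (intro mult_left_mono diffP) auto
      also have "\<dots> \<le> 1/2 * (B * (1/2)^i)"
        using s B0 mult_right_mono[of "L * s" "1/2" "B * (1/2)^i"] by (simp add: mult.assoc)
      finally show "norm (V (Suc (Suc i)) t - V (Suc i) t) \<le> B * (1/2)^Suc i"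
        by simp
    qed
  qed
  have uniform: "uniform_limit {0..s} (\<lambda>n t. \<Sum>i<n. V (Suc i) t - V i t)
      (\<lambda>t. \<Sum>i. V (Suc i) t - V i t) sequentially"
    using step by (intro Weierstrass_m_test[where M="\<lambda>i. B * (1/2)^i"]) (auto intro!: summable_mult summable_geometric)
  define w where "w t = v0 + (\<Sum>i. V (Suc i) t - V i t)" for t
  have tele: "v0 + (\<Sum>i<n. V (Suc i) t - V i t) = V n t" for n t
    by (induction n) (simp_all add: V0 algebra_simps)
  have "uniform_limit {0..s} (\<lambda>n t. v0 + (\<Sum>i<n. V (Suc i) t - V i t)) w sequentially"
    unfolding w_def using uniform by (intro uniform_limit_intros)
  then have lim: "uniform_limit {0..s} V w sequentially"
    by (simp add: tele)
  have contw: "continuous_on {0..s} w"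
    using contV by (intro uniform_limit_theorem[OF _ lim]) auto
  have close: "\<forall>\<^sub>F n in sequentially. \<forall>t\<in>{0..s}. norm (V n t - w t) \<le> e" if "e > 0" for e
    using uniform_limitD[OF lim that] by eventually_elim (auto simp: dist_norm intro: less_imp_le)
  show thesis
  proof (rule that[OF contw])
    fix t assume t: "t \<in> {0..s}"
    \<comment> \<open>The inclusion passes to the limit: \<open>V (Suc n) t\<close> lies in the
      value of \<open>G\<close> at \<open>P (V n) t\<close>, which is close to the value at
      \<open>P w t\<close>, and values of \<open>G\<close> are closed.\<close>
    have "w t \<in> closure (G (P w t))"
      unfolding closure_approachable
    proof (intro allI impI)
      fix e :: real assume e: "e > 0"
      define d where "d = e / 3"
      have d: "d > 0"
        using e by (simp add: d_def)
      obtain n where n: "\<forall>k\<ge>n. \<forall>t\<in>{0..s}. norm (V k t - w t) \<le> d"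
        using close[OF d] unfolding eventually_sequentially by blast
      obtain u where u: "u \<in> G (P w t)" "norm (V (Suc n) t - u) \<le> L * norm (P (V n) t - P w t)"
        using L[OF inG] by blast
      have "norm (P (V n) t - P w t) \<le> s * d"
        using n d t contV contw by (intro diffP) (auto simp: norm_minus_commute)
      then have "L * norm (P (V n) t - P w t) \<le> L * s * d"
        using L0 by (simp add: mult.assoc mult_left_mono)
      also have "\<dots> \<le> 1/2 * d"
        using s d by (intro mult_right_mono) auto
      finally have "norm (V (Suc n) t - u) \<le> d"
        using u d by simp
      moreover have "norm (V (Suc n) t - w t) \<le> d"
        using n t by simp
      ultimately have "norm (u - w t) \<le> d + d"
        using norm_triangle_ineq4[of "V (Suc n) t - w t" "V (Suc n) t - u"] by simp
      then show "\<exists>u\<in>G (P w t). dist u (w t) < e"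
        using u(1) d by (intro bexI[of _ u]) (auto simp: dist_norm d_def)
    qed
    then show "w t \<in> G (x - integral {t..s} w)"
      using G(2) by (simp add: closure_closed P_def)
    have "norm (w t - v0) \<le> (\<Sum>i. B * (1/2)^i)"
      unfolding w_def add_diff_cancel_left' using step t
      by (intro norm_suminf_le summable_mult summable_geometric) auto
    also have "\<dots> = 2 * B"
      by (subst suminf_mult) (simp_all add: summable_geometric suminf_geometric)
    finally show "norm (w t - v0) \<le> 2 * L * (norm (x - \<alpha>) + s * norm v0)"
      by (simp add: B_def)
  qed
qed

section \<open>Existence and growth of trajectories near a base point\<close>

locale lipschitz_inclusion =
  fixes F :: "'a::euclidean_space \<Rightarrow> 'a set"
  assumes nonempty: "F x \<noteq> {}" and compact: "compact (F x)" and convex: "convex (F x)"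
    and locally_lipschitz: "\<exists>L. \<forall>x\<in>cball \<alpha> 1. \<forall>y\<in>cball \<alpha> 1. \<forall>u\<in>F x. \<exists>w\<in>F y. norm (u - w) \<le> L * norm (x - y)"
begin

text \<open>Speeds on the unit ball are bounded by a bound for the compact set
  \<open>F \<alpha>\<close> plus \<open>L\<close> times the radius 1.\<close>

lemma local_constants:
  obtains L M where "0 \<le> L" "0 < M"
    "\<forall>x\<in>cball \<alpha> 1. \<forall>y\<in>cball \<alpha> 1. \<forall>u\<in>F x. \<exists>w\<in>F y. norm (u - w) \<le> L * norm (x - y)"
    "\<forall>x\<in>cball \<alpha> 1. \<forall>u\<in>F x. norm u \<le> M"
proof -
  obtain L0 where L0: "\<forall>x\<in>cball \<alpha> 1. \<forall>y\<in>cball \<alpha> 1. \<forall>u\<in>F x. \<exists>w\<in>F y. norm (u - w) \<le> L0 * norm (x - y)"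
    using locally_lipschitz by blast
  define L where "L = \<bar>L0\<bar>"
  have "L0 * norm z \<le> L * norm z" for z :: 'a
    unfolding L_def by (intro mult_right_mono) auto
  then have L: "\<forall>x\<in>cball \<alpha> 1. \<forall>y\<in>cball \<alpha> 1. \<forall>u\<in>F x. \<exists>w\<in>F y. norm (u - w) \<le> L * norm (x - y)"
    using L0 by (meson order_trans)
  obtain b where b: "0 < b" "\<forall>u\<in>F \<alpha>. norm u \<le> b"
    using compact_imp_bounded[OF compact] bounded_pos by blast
  have "norm u \<le> b + L" if x: "x \<in> cball \<alpha> 1" and u: "u \<in> F x" for x u
  proof -
    obtain w where w: "w \<in> F \<alpha>" "norm (u - w) \<le> L * norm (x - \<alpha>)"
      using L[rule_format, OF x _ u, of \<alpha>] by auto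
    have "L * norm (x - \<alpha>) \<le> L * 1"
      using x by (intro mult_left_mono) (auto simp: L_def dist_norm norm_minus_commute)
    then have "norm (u - w) \<le> L"
      using w by simp
    moreover have "norm w \<le> b"
      using b w by blast
    ultimately show ?thesis
      using norm_triangle_ineq[of w "u - w"] by simp
  qed
  moreover have "0 \<le> L" "0 < b + L"
    using b by (simp_all add: L_def)
  ultimately show thesis
    using that L by blast
qed

text \<open>This makes arriving at \<open>x\<close> with velocity \<open>v\<close> precise although
  \<open>v\<close> is admissible only at \<open>\<alpha>\<close>. The error is of second order
  jointly in \<open>s\<close> and \<open>norm (x - \<alpha>)\<close>, with \<open>\<rho>\<close> and
  \<open>K\<close> independent of \<open>x\<close>, \<open>s\<close> and \<open>v\<close>, so that
  all end points near \<open>\<alpha>\<close> are covered uniformly.\<close>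

lemma backward_trajectory:
  obtains \<rho> K where "\<rho> > 0" "K \<ge> 0"
    "\<forall>x s v. norm (x - \<alpha>) \<le> \<rho> \<longrightarrow> 0 \<le> s \<longrightarrow> s \<le> \<rho> \<longrightarrow> v \<in> F \<alpha> \<longrightarrow>
      (\<exists>z. trajectory_on F {0..s} z \<and> z s = x \<and>
        norm (z 0 - (x - s *\<^sub>R v)) \<le> K * s * (norm (x - \<alpha>) + s))"
proof -
  obtain L M where LM: "0 \<le> L" "0 < M"
    "\<forall>x\<in>cball \<alpha> 1. \<forall>y\<in>cball \<alpha> 1. \<forall>u\<in>F x. \<exists>w\<in>F y. norm (u - w) \<le> L * norm (x - y)"
    "\<forall>x\<in>cball \<alpha> 1. \<forall>u\<in>F x. norm u \<le> M"
    by (rule local_constants)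
  \<comment> \<open>This value gives \<open>L * \<rho> \<le> 1 / 2\<close> for the contraction, and
    it turns the displacement bound \<open>(M + 2 * L * (1 + M)) * \<rho>\<close> into exactly
    \<open>1 - \<rho>\<close>, so a curve ending within \<open>\<rho>\<close> of
    \<open>\<alpha>\<close> stays in the unit ball.\<close>
  define \<rho> where "\<rho> = 1 / ((1 + M) * (1 + 2 * L))"
  define K where "K = 2 * L * (1 + M)"
  have \<rho>: "0 < \<rho>" "\<rho> * (1 + M) * (1 + 2 * L) = 1"
    using LM by (simp_all add: \<rho>_def)
  have "1 * (1 + 2 * L) \<le> (1 + M) * (1 + 2 * L)"
    using LM by (intro mult_right_mono) auto
  then have "\<rho> * (1 + 2 * L) \<le> 1"
    using \<rho> mult_left_mono[of "1 + 2 * L" "(1 + M) * (1 + 2 * L)" \<rho>] by (simp add: mult.assoc)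
  moreover have "0 \<le> L * \<rho>"
    using LM \<rho> by simp
  ultimately have \<rho>1: "\<rho> \<le> 1" and L\<rho>: "L * \<rho> \<le> 1 / 2"
    using \<rho>(1) by (simp_all add: algebra_simps)
  \<comment> \<open>Composing \<open>F\<close> with the projection onto the unit ball gives a map
    that is Lipschitz on the whole space; the solution is later seen to stay where \<open>G\<close>
    and \<open>F\<close> coincide.\<close>
  define G where "G x = F (closest_point (cball \<alpha> 1) x)" for x
  have proj: "closest_point (cball \<alpha> 1) x \<in> cball \<alpha> 1" for x
    by (rule closest_point_in_set) auto
  have G: "convex (G x)" "closed (G x)" "G x \<noteq> {}" for x
    using convex compact nonempty compact_imp_closed by (auto simp: G_def)
  have G_eq: "G x = F x" if "x \<in> cball \<alpha> 1" for x
    using that by (simp add: G_def closest_point_self)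
  have GL: "\<exists>w\<in>G y. norm (u - w) \<le> L * norm (x - y)" if uG: "u \<in> G x" for x y u
  proof -
    let ?p = "closest_point (cball \<alpha> 1)"
    obtain w where w: "w \<in> F (?p y)" "norm (u - w) \<le> L * norm (?p x - ?p y)"
      using LM(3)[rule_format, OF proj proj, of u x y] uG unfolding G_def by auto
    have "norm (?p x - ?p y) \<le> norm (x - y)"
      using closest_point_lipschitz[of "cball \<alpha> 1" x y] by (simp add: dist_norm)
    then have "L * norm (?p x - ?p y) \<le> L * norm (x - y)"
      using LM(1) by (rule mult_left_mono)
    then show ?thesis
      using w by (intro bexI[of _ w]) (auto simp: G_def)
  qed
  have "\<exists>z. trajectory_on F {0..s} z \<and> z s = x \<and>
        norm (z 0 - (x - s *\<^sub>R v)) \<le> K * s * (norm (x - \<alpha>) + s)"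
    if x: "norm (x - \<alpha>) \<le> \<rho>" and s: "0 \<le> s" "s \<le> \<rho>" and v: "v \<in> F \<alpha>" for x s v
  proof -
    have Ls: "L * s \<le> 1 / 2"
      using mult_left_mono[OF s(2) LM(1)] L\<rho> by simp
    have v': "v \<in> G \<alpha>"
      using v G_eq[of \<alpha>] by simp
    obtain w where w: "continuous_on {0..s} w"
      "\<And>t. t \<in> {0..s} \<Longrightarrow> w t \<in> G (x - integral {t..s} w)"
      "\<And>t. t \<in> {0..s} \<Longrightarrow> norm (w t - v) \<le> 2 * L * (norm (x - \<alpha>) + s * norm v)"
      using lipschitz_inclusion_backward_solution[OF G GL LM(1) s(1) Ls v', of x] by blast
    have vM: "norm v \<le> M"
      using LM(4)[rule_format, OF _ v] by simp
    have wv: "norm (w t - v) \<le> K * (norm (x - \<alpha>) + s)" if "t \<in> {0..s}" for t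
    proof -
      have "s * norm v \<le> s * M" "0 \<le> M * norm (x - \<alpha>)"
        using vM s LM by (auto intro: mult_left_mono)
      then have "norm (x - \<alpha>) + s * norm v \<le> (1 + M) * (norm (x - \<alpha>) + s)"
        using s by (simp add: algebra_simps)
      then have "2 * L * (norm (x - \<alpha>) + s * norm v) \<le> 2 * L * ((1 + M) * (norm (x - \<alpha>) + s))"
        using LM by (intro mult_left_mono) auto
      then show ?thesis
        using w(3)[OF that] by (simp add: K_def mult.assoc)
    qed
    have K0: "0 \<le> K"
      using LM by (simp add: K_def)
    define C where "C = M + 2 * L * (\<rho> * (1 + M))"
    have wC: "norm (w t) \<le> C" if "t \<in> {0..s}" for t
    proof -
      have "s * norm v \<le> \<rho> * M"
        using s vM LM by (intro mult_mono) auto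
      then have "norm (x - \<alpha>) + s * norm v \<le> \<rho> * (1 + M)"
        using x by (simp add: algebra_simps)
      then have "2 * L * (norm (x - \<alpha>) + s * norm v) \<le> 2 * L * (\<rho> * (1 + M))"
        using LM by (intro mult_left_mono) auto
      then show ?thesis
        using w(3)[OF that] vM norm_triangle_ineq[of v "w t - v"] by (simp add: C_def)
    qed
    have C0: "0 \<le> C"
      using LM \<rho> by (simp add: C_def)
    define z where "z t = x - integral {t..s} w" for t
    have zball: "z t \<in> cball \<alpha> 1" if "t \<in> {0..s}" for t
    proof -
      have "norm (integral {t..s} w) \<le> C * s"
        using w(1) wC C0 that by (intro norm_integral_le) auto
      also have "\<dots> \<le> C * \<rho>"
        using s C0 by (intro mult_left_mono) auto
      also have "\<dots> \<le> (M + 2 * L * (1 + M)) * \<rho>"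
      proof (rule mult_right_mono)
        have "\<rho> * (1 + M) \<le> 1 * (1 + M)"
          using \<rho>1 LM by (intro mult_right_mono) auto
        then have "2 * L * (\<rho> * (1 + M)) \<le> 2 * L * (1 + M)"
          using LM by (intro mult_left_mono) auto
        then show "C \<le> M + 2 * L * (1 + M)"
          by (simp add: C_def)
      qed (use \<rho> in simp)
      also have "\<dots> = 1 - \<rho>"
        using \<rho>(2) by (simp add: algebra_simps)
      finally have "norm (integral {t..s} w) \<le> 1 - \<rho>" .
      then have "norm (z t - \<alpha>) \<le> 1"
        using x norm_triangle_ineq4[of "x - \<alpha>" "integral {t..s} w"] by (simp add: z_def algebra_simps)
      then show ?thesis
        by (simp add: dist_norm norm_minus_commute)
    qed
    have intw: "w integrable_on {0..s}"
      using w(1) by (rule integrable_continuous_real)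
    \<comment> \<open>A fixed lower limit allows differentiation of the integral in its upper
      limit.\<close>
    have zeq: "z t = x - integral {0..s} w + integral {0..t} w" if "t \<in> {0..s}" for t
      using Henstock_Kurzweil_Integration.integral_combine[of 0 t s w] that intw
      by (simp add: z_def algebra_simps)
    have der: "(z has_vector_derivative w t) (at t within {0..s})" if "t \<in> {0..s}" for t
    proof -
      have "((\<lambda>t. x - integral {0..s} w + integral {0..t} w) has_vector_derivative w t) (at t within {0..s})"
        using integral_has_vector_derivative[OF w(1) that] by (auto intro!: derivative_eq_intros)
      then show ?thesis
        by (rule has_vector_derivative_transform[OF that, rotated]) (simp add: zeq)
    qed
    have "norm (z b - z a) \<le> C * (b - a)" if ab: "a \<in> {0..s}" "b \<in> {0..s}" "a \<le> b" for a b
    proof -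
      have "integral {0..b} w = integral {0..a} w + integral {a..b} w"
        using Henstock_Kurzweil_Integration.integral_combine[of 0 a b w] ab
          integrable_on_subinterval[OF intw, of 0 b] by auto
      then have "z b - z a = integral {a..b} w"
        using ab by (simp add: zeq)
      moreover have "norm (integral {a..b} w) \<le> C * (b - a)"
        using ab wC by (intro integral_bound continuous_on_subset[OF w(1)]) auto
      ultimately show ?thesis
        by simp
    qed
    then have "absolutely_continuous_on {0..s} z"
      by (rule lipschitz_imp_absolutely_continuous_on)
    moreover have "w t \<in> F (z t)" if "t \<in> {0..s}" for t
      using w(2)[OF that] G_eq[OF zball[OF that]] by (simp add: z_def)
    ultimately have "trajectory_on F {0..s} z"
      unfolding trajectory_on_iff using der by (intro conjI exI[of _ "{}"] ballI bexI[of _ "w _"]) auto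
    moreover have "z s = x"
      by (simp add: z_def)
    moreover have "norm (z 0 - (x - s *\<^sub>R v)) \<le> K * s * (norm (x - \<alpha>) + s)"
    proof -
      have "integral {0..s} (\<lambda>t. w t - v) = integral {0..s} w - s *\<^sub>R v"
        using intw s by (subst integral_diff) auto
      then have "norm (z 0 - (x - s *\<^sub>R v)) = norm (integral {0..s} (\<lambda>t. w t - v))"
        by (simp add: z_def norm_minus_commute)
      moreover have "norm (integral {0..s} (\<lambda>t. w t - v)) \<le> K * (norm (x - \<alpha>) + s) * s"
        using w(1) wv K0 s by (intro norm_integral_le continuous_intros) auto
      ultimately show ?thesis
        by (simp add: mult_ac)
    qed
    ultimately show ?thesis
      by blast
  qed
  moreover have "0 \<le> K"
    using LM by (simp add: K_def)
  ultimately show thesis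
    using that[OF \<rho>(1)] by blast
qed

text \<open>Every velocity met by a short trajectory is close to an element of
  \<open>F \<alpha>\<close>, so a bound over \<open>F \<alpha>\<close> controls the motion in
  direction \<open>\<zeta>\<close> up to second order. The estimates hold for all trajectories,
  hence for near optimal ones about which nothing else is known.\<close>

lemma forward_estimate:
  obtains \<rho> L M where "\<rho> > 0" "L \<ge> 0" "M > 0"
    "\<forall>x \<tau> t. trajectory_on F {0..\<tau>} x \<longrightarrow> norm (x 0 - \<alpha>) \<le> 1/2 \<longrightarrow> 0 \<le> t \<longrightarrow> t \<le> \<tau> \<longrightarrow> t \<le> \<rho> \<longrightarrow>
       norm (x t - x 0) \<le> M * t"
    "\<forall>x \<tau> t \<zeta> h. trajectory_on F {0..\<tau>} x \<longrightarrow> norm (x 0 - \<alpha>) \<le> 1/2 \<longrightarrow> 0 \<le> t \<longrightarrow> t \<le> \<tau> \<longrightarrow> t \<le> \<rho> \<longrightarrow>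
       (\<forall>v\<in>F \<alpha>. inner \<zeta> v \<le> h) \<longrightarrow>
       inner \<zeta> (x t - x 0) \<le> t * (h + norm \<zeta> * (L * (norm (x 0 - \<alpha>) + M * t)))"
proof -
  obtain L M where LM: "0 \<le> L" "0 < M"
    "\<forall>x\<in>cball \<alpha> 1. \<forall>y\<in>cball \<alpha> 1. \<forall>u\<in>F x. \<exists>w\<in>F y. norm (u - w) \<le> L * norm (x - y)"
    "\<forall>x\<in>cball \<alpha> 1. \<forall>u\<in>F x. norm u \<le> M"
    by (rule local_constants)
  \<comment> \<open>In time \<open>1 / (4 * M)\<close> at speed at most \<open>M\<close> a
    trajectory moves at most 1/4; starting within 1/2 of \<open>\<alpha>\<close> it remains within
    3/4.\<close>
  define \<rho> where "\<rho> = 1 / (4 * M)"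
  have \<rho>: "\<rho> > 0"
    using LM by (simp add: \<rho>_def)
  have incr: "inner \<zeta> (x t - x 0) \<le> c * t"
    if traj: "trajectory_on F {0..t} x" and t: "0 \<le> t"
      and c: "\<And>r v. 0 \<le> r \<Longrightarrow> r < t \<Longrightarrow> v \<in> F (x r) \<Longrightarrow> inner \<zeta> v \<le> c" for x t \<zeta> c
  proof -
    obtain N where N: "negligible N"
      "\<And>r. r \<in> {0..t} - N \<Longrightarrow> \<exists>v\<in>F (x r). (x has_vector_derivative v) (at r within {0..t})"
      using traj unfolding trajectory_on_iff by blast
    have "inner \<zeta> (x t - x 0) \<le> c * (t - 0)"
    proof (rule absolutely_continuous_increment_le)
      show "absolutely_continuous_on {0..t} x"
        using traj trajectory_on_iff by blast
      \<comment> \<open>The end time is put into the null set so that velocities need bounding only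
        for \<open>r < t\<close>; a first exit time can then serve as \<open>t\<close>.\<close>
      show "negligible (insert t N)"
        using N(1) by simp
      show "\<exists>v. (x has_vector_derivative v) (at r within {0..t}) \<and> inner \<zeta> v \<le> c"
        if r: "r \<in> {0..t} - insert t N" for r
        using N(2)[of r] c[of r] r by fastforce
    qed (use t in simp)
    then show ?thesis
      by simp
  qed
  have speed: "norm (x t - x 0) \<le> M * t"
    if traj: "trajectory_on F {0..t} x" and t: "0 \<le> t"
      and b: "\<And>r. 0 \<le> r \<Longrightarrow> r < t \<Longrightarrow> x r \<in> cball \<alpha> 1" for x t
  proof -
    \<comment> \<open>Testing the increment in its own direction turns directional bounds into a
      bound on its norm.\<close>
    define \<zeta> where "\<zeta> = x t - x 0"
    have "inner \<zeta> (x t - x 0) \<le> norm \<zeta> * M * t"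
    proof (rule incr[OF traj t])
      fix r v assume "0 \<le> r" "r < t" "v \<in> F (x r)"
      then have "norm v \<le> M"
        using b LM(4) by blast
      then show "inner \<zeta> v \<le> norm \<zeta> * M"
        by (rule inner_le_norm_mult)
    qed
    then have "norm \<zeta> * norm \<zeta> \<le> norm \<zeta> * (M * t)"
      by (simp add: \<zeta>_def power2_norm_eq_inner[symmetric] power2_eq_square mult.assoc)
    then show ?thesis
      using t LM(2) by (cases "\<zeta> = 0") (auto simp: \<zeta>_def)
  qed
  have stay: "x t \<in> cball \<alpha> 1"
    if traj: "trajectory_on F {0..\<tau>} x" and x0: "norm (x 0 - \<alpha>) \<le> 1/2" and t: "0 \<le> t" "t \<le> \<tau>" "t \<le> \<rho>"
    for x \<tau> t
  proof (rule ccontr)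
    assume out: "x t \<notin> cball \<alpha> 1"
    \<comment> \<open>The times at distance at least 1 form a compact set. Before its minimum the
      speed bound applies, so at the minimum the distance would be at most 3/4.\<close>
    define S where "S = {r \<in> {0..t}. 1 \<le> norm (x r - \<alpha>)}"
    have cont: "continuous_on {0..t} x"
      using traj t absolutely_continuous_on_imp_continuous_on continuous_on_subset[of "{0..\<tau>}" x "{0..t}"]
      unfolding trajectory_on_iff by auto
    have "S = {0..t} \<inter> (\<lambda>r. norm (x r - \<alpha>)) -` {1..}"
      by (auto simp: S_def)
    moreover have "closed ({0..t} \<inter> (\<lambda>r. norm (x r - \<alpha>)) -` {1..})"
      using cont by (intro continuous_closed_preimage continuous_intros) auto
    ultimately have "closed S"
      by simp
    moreover have "bounded S"
      by (rule bounded_subset[of "{0..t}"]) (auto simp: S_def)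
    ultimately have "compact S"
      by (simp add: compact_eq_bounded_closed)
    moreover have "t \<in> S"
      using out t by (auto simp: S_def dist_norm norm_minus_commute)
    ultimately obtain r where r: "r \<in> S" "\<And>q. q \<in> S \<Longrightarrow> r \<le> q"
      using compact_attains_inf[of S] by blast
    have "norm (x r - x 0) \<le> M * r"
    proof (rule speed)
      show "trajectory_on F {0..r} x"
        using traj t r by (intro trajectory_on_subset[OF traj]) (auto simp: S_def)
      show "0 \<le> r"
        using r by (simp add: S_def)
      show "x q \<in> cball \<alpha> 1" if "0 \<le> q" "q < r" for q
        using r(2)[of q] r(1) that by (force simp: S_def dist_norm norm_minus_commute)
    qed
    also have "\<dots> \<le> M * \<rho>"
      using r t LM by (intro mult_left_mono) (auto simp: S_def)
    also have "\<dots> = 1/4"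
      using LM by (simp add: \<rho>_def)
    finally have "norm (x r - \<alpha>) \<le> 1/4 + 1/2"
      using x0 norm_triangle_ineq[of "x r - x 0" "x 0 - \<alpha>"] by simp
    then show False
      using r(1) by (simp add: S_def)
  qed
  have est: "norm (x t - x 0) \<le> M * t"
    if traj: "trajectory_on F {0..\<tau>} x" and x0: "norm (x 0 - \<alpha>) \<le> 1/2" and t: "0 \<le> t" "t \<le> \<tau>" "t \<le> \<rho>"
    for x \<tau> t
  proof (rule speed)
    show "trajectory_on F {0..t} x"
      using t by (intro trajectory_on_subset[OF traj]) auto
    show "x r \<in> cball \<alpha> 1" if "0 \<le> r" "r < t" for r
      using t that by (intro stay[OF traj x0]) auto
  qed (rule t)
  have "inner \<zeta> (x t - x 0) \<le> t * (h + norm \<zeta> * (L * (norm (x 0 - \<alpha>) + M * t)))"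
    if traj: "trajectory_on F {0..\<tau>} x" and x0: "norm (x 0 - \<alpha>) \<le> 1/2" and t: "0 \<le> t" "t \<le> \<tau>" "t \<le> \<rho>"
      and h: "\<forall>v\<in>F \<alpha>. inner \<zeta> v \<le> h"
    for x \<tau> t \<zeta> h
  proof -
    have "inner \<zeta> (x t - x 0) \<le> (h + norm \<zeta> * (L * (norm (x 0 - \<alpha>) + M * t))) * t"
    proof (rule incr)
      show "trajectory_on F {0..t} x"
        using t by (intro trajectory_on_subset[OF traj]) auto
      fix r v assume r: "0 \<le> r" "r < t" and v: "v \<in> F (x r)"
      have ball: "x r \<in> cball \<alpha> 1"
        using r t by (intro stay[OF traj x0]) auto
      obtain w where w: "w \<in> F \<alpha>" "norm (v - w) \<le> L * norm (x r - \<alpha>)"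
        using LM(3)[rule_format, OF ball _ v, of \<alpha>] by auto
      have "norm (x r - x 0) \<le> M * r"
        using r t by (intro est[OF traj x0]) auto
      also have "\<dots> \<le> M * t"
        using r LM by (intro mult_left_mono) auto
      finally have "norm (x r - \<alpha>) \<le> norm (x 0 - \<alpha>) + M * t"
        using norm_triangle_ineq[of "x r - x 0" "x 0 - \<alpha>"] by simp
      then have "L * norm (x r - \<alpha>) \<le> L * (norm (x 0 - \<alpha>) + M * t)"
        using LM(1) by (rule mult_left_mono)
      then have "norm (v - w) \<le> L * (norm (x 0 - \<alpha>) + M * t)"
        using w by simp
      then have "inner \<zeta> (v - w) \<le> norm \<zeta> * (L * (norm (x 0 - \<alpha>) + M * t))"
        by (rule inner_le_norm_mult)
      moreover have "inner \<zeta> w \<le> h"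
        using h w by blast
      ultimately show "inner \<zeta> v \<le> h + norm \<zeta> * (L * (norm (x 0 - \<alpha>) + M * t))"
        by (simp add: inner_diff_right)
    qed (rule t)
    then show ?thesis
      by (simp add: mult.commute)
  qed
  then show thesis
    using that[OF \<rho> LM(1,2)] est by blast
qed

end

subsection \<open>Normal cones\<close>

text \<open>The point \<open>y = x\<close> may be included because both sides of the inequality
  vanish there.\<close>

lemma frechet_normal_cone_iff:
  "\<zeta> \<in> frechet_normal_cone S x \<longleftrightarrow>
    (\<forall>\<epsilon>>0. \<exists>\<delta>>0. \<forall>y\<in>S. norm (y - x) < \<delta> \<longrightarrow> inner \<zeta> (y - x) \<le> \<epsilon> * norm (y - x))"
  (is "_ \<longleftrightarrow> ?R")
proof -
  let ?q = "\<lambda>y. ereal (inner \<zeta> (y - x) / norm (y - x))"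
  have "\<zeta> \<in> frechet_normal_cone S x \<longleftrightarrow> (\<forall>c>0. \<forall>\<^sub>F y in at x within S. ?q y < c)"
    unfolding frechet_normal_cone_def by (simp add: Limsup_le_iff)
  also have "\<dots> \<longleftrightarrow> ?R"
  proof (intro iffI allI impI)
    fix \<epsilon> :: real
    assume q: "\<forall>c>0. \<forall>\<^sub>F y in at x within S. ?q y < c" and "\<epsilon> > 0"
    have "\<forall>\<^sub>F y in at x within S. ?q y < ereal \<epsilon>"
      by (rule q[rule_format]) (use \<open>\<epsilon> > 0\<close> in simp)
    then obtain d where d: "d > 0" "\<And>y. y \<in> S \<Longrightarrow> y \<noteq> x \<Longrightarrow> dist y x < d \<Longrightarrow> ?q y < ereal \<epsilon>"
      unfolding eventually_at by blast
    have "inner \<zeta> (y - x) \<le> \<epsilon> * norm (y - x)" if "y \<in> S" "norm (y - x) < d" for y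
      using d(2)[of y] that by (cases "y = x") (auto simp: dist_norm field_simps)
    then show "\<exists>\<delta>>0. \<forall>y\<in>S. norm (y - x) < \<delta> \<longrightarrow> inner \<zeta> (y - x) \<le> \<epsilon> * norm (y - x)"
      using d(1) by blast
  next
    fix c :: ereal
    assume R: ?R and "c > 0"
    then obtain \<epsilon> where \<epsilon>: "0 < \<epsilon>" "ereal \<epsilon> < c"
      using ereal_dense2[of 0 c] by auto
    then obtain \<delta> where \<delta>: "\<delta> > 0"
      "\<And>y. y \<in> S \<Longrightarrow> norm (y - x) < \<delta> \<Longrightarrow> inner \<zeta> (y - x) \<le> \<epsilon> * norm (y - x)"
      using R by blast
    have "?q y < c" if "y \<in> S" "y \<noteq> x" "dist y x < \<delta>" for y
    proof -
      have "?q y \<le> ereal \<epsilon>"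
        using \<delta>(2)[of y] that by (simp add: dist_norm field_simps)
      then show ?thesis
        using \<epsilon>(2) by (rule order_le_less_trans)
    qed
    then show "\<forall>\<^sub>F y in at x within S. ?q y < c"
      unfolding eventually_at using \<delta>(1) by blast
  qed
  finally show ?thesis .
qed

lemma frechet_normal_cone_scaleR:
  assumes "\<zeta> \<in> frechet_normal_cone S x" "0 \<le> c"
  shows "c *\<^sub>R \<zeta> \<in> frechet_normal_cone S x"
  unfolding frechet_normal_cone_iff
proof (intro allI impI)
  fix \<epsilon> :: real assume "\<epsilon> > 0"
  \<comment> \<open>Dividing by \<open>c + 1\<close> covers \<open>c = 0\<close>.\<close>
  then have "\<epsilon> / (c + 1) > 0"
    using assms(2) by simp
  then obtain \<delta> where \<delta>: "\<delta> > 0"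
    "\<And>y. y \<in> S \<Longrightarrow> norm (y - x) < \<delta> \<Longrightarrow> inner \<zeta> (y - x) \<le> \<epsilon> / (c + 1) * norm (y - x)"
    using assms(1) unfolding frechet_normal_cone_iff by blast
  have "c * (\<epsilon> / (c + 1)) \<le> \<epsilon>"
    using assms(2) \<open>\<epsilon> > 0\<close> by (simp add: field_simps)
  then have "c * (\<epsilon> / (c + 1)) * norm (y - x) \<le> \<epsilon> * norm (y - x)" for y
    by (rule mult_right_mono) simp
  moreover have "inner (c *\<^sub>R \<zeta>) (y - x) \<le> c * (\<epsilon> / (c + 1)) * norm (y - x)"
    if "y \<in> S" "norm (y - x) < \<delta>" for y
    using mult_left_mono[OF \<delta>(2)[OF that] assms(2)] by (simp add: mult.assoc)
  ultimately show "\<exists>\<delta>>0. \<forall>y\<in>S. norm (y - x) < \<delta> \<longrightarrow> inner (c *\<^sub>R \<zeta>) (y - x) \<le> \<epsilon> * norm (y - x)"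
    using \<delta>(1) by (meson order_trans)
qed

lemma frechet_normal_cone_add:
  assumes "\<zeta> \<in> frechet_normal_cone S x" "\<eta> \<in> frechet_normal_cone S x"
  shows "\<zeta> + \<eta> \<in> frechet_normal_cone S x"
  unfolding frechet_normal_cone_iff
proof (intro allI impI)
  fix \<epsilon> :: real assume "\<epsilon> > 0"
  then have e2: "\<epsilon> / 2 > 0"
    by simp
  obtain \<delta>1 where \<delta>1: "\<delta>1 > 0"
    "\<And>y. y \<in> S \<Longrightarrow> norm (y - x) < \<delta>1 \<Longrightarrow> inner \<zeta> (y - x) \<le> \<epsilon> / 2 * norm (y - x)"
    using assms(1) e2 unfolding frechet_normal_cone_iff by blast
  obtain \<delta>2 where \<delta>2: "\<delta>2 > 0"
    "\<And>y. y \<in> S \<Longrightarrow> norm (y - x) < \<delta>2 \<Longrightarrow> inner \<eta> (y - x) \<le> \<epsilon> / 2 * norm (y - x)"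
    using assms(2) e2 unfolding frechet_normal_cone_iff by blast
  have "inner (\<zeta> + \<eta>) (y - x) \<le> \<epsilon> * norm (y - x)" if "y \<in> S" "norm (y - x) < min \<delta>1 \<delta>2" for y
    using \<delta>1(2)[of y] \<delta>2(2)[of y] that by (simp add: inner_add_left)
  then show "\<exists>\<delta>>0. \<forall>y\<in>S. norm (y - x) < \<delta> \<longrightarrow> inner (\<zeta> + \<eta>) (y - x) \<le> \<epsilon> * norm (y - x)"
    using \<delta>1(1) \<delta>2(1) by (intro exI[of _ "min \<delta>1 \<delta>2"]) simp
qed

lemma mem_reachable_within: "p \<in> reachable_within F t \<longleftrightarrow> min_time F p \<le> ereal t"
  by (simp add: reachable_within_def)

lemma mem_min_time_epi: "(p, \<mu>) \<in> min_time_epi F \<longleftrightarrow> min_time F p \<le> ereal \<mu>"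
  by (auto simp: min_time_epi_def intro: order_le_less_trans)

lemma mult_half_divide: "a \<noteq> 0 \<Longrightarrow> a * (d / 2 / a) = d / 2" for a d :: real
  by simp

text \<open>\<open>\<epsilon>\<close> comes from the definition of a normal and is fixed first;
  \<open>\<rho>\<close> may depend on it. Only then does \<open>s\<close> tend to 0 and remove the
  second order errors, which have become \<open>C * s\<close> after division by
  \<open>s\<close>.\<close>

lemma le_of_small_errors:
  fixes a :: real
  assumes "\<And>\<epsilon>. \<epsilon> > 0 \<Longrightarrow> \<exists>\<rho>>0. \<forall>s. 0 < s \<longrightarrow> s \<le> \<rho> \<longrightarrow> a \<le> b + K * \<epsilon> + C * s"
  shows "a \<le> b"
proof (rule field_le_epsilon)
  fix e :: real assume e: "e > 0"
  define \<epsilon> where "\<epsilon> = e / (2 * (\<bar>K\<bar> + 1))"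
  have \<epsilon>: "\<epsilon> > 0"
    using e by (simp add: \<epsilon>_def)
  have "K * \<epsilon> \<le> (\<bar>K\<bar> + 1) * \<epsilon>"
    using \<epsilon> by (intro mult_right_mono) auto
  also have "\<dots> = e / 2"
    unfolding \<epsilon>_def by (simp add: field_simps)
  finally have K: "K * \<epsilon> \<le> e / 2" .
  obtain \<rho> where \<rho>: "\<rho> > 0" "\<And>s. 0 < s \<Longrightarrow> s \<le> \<rho> \<Longrightarrow> a \<le> b + K * \<epsilon> + C * s"
    using assms[OF \<epsilon>] by blast
  define s where "s = min \<rho> (e / (2 * (\<bar>C\<bar> + 1)))"
  have s: "s > 0" "s \<le> \<rho>"
    using \<rho>(1) e by (auto simp: s_def)
  have "C * s \<le> (\<bar>C\<bar> + 1) * (e / (2 * (\<bar>C\<bar> + 1)))"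
    using s(1) e by (intro mult_mono) (auto simp: s_def)
  also have "\<dots> = e / 2"
    by (simp add: field_simps)
  finally show "a \<le> b + e"
    using \<rho>(2)[OF s] K by simp
qed

section \<open>Normals to the sublevel set and to the epigraph\<close>

context lipschitz_inclusion
begin

text \<open>The support function of \<open>- F \<alpha>\<close>. The sign belongs to backward
  motion: arriving with velocity \<open>v\<close> shifts the starting point by about
  \<open>- s *\<^sub>R v\<close>.\<close>

definition hamiltonian :: "'a \<Rightarrow> 'a \<Rightarrow> real" where
  "hamiltonian \<alpha> \<zeta> = (SUP v\<in>F \<alpha>. - inner \<zeta> v)"

lemma hamiltonian_attained: "\<exists>v\<in>F \<alpha>. hamiltonian \<alpha> \<zeta> = - inner \<zeta> v"
  and hamiltonian_upper: "v \<in> F \<alpha> \<Longrightarrow> - inner \<zeta> v \<le> hamiltonian \<alpha> \<zeta>"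
proof -
  have "continuous_on (F \<alpha>) (\<lambda>v. - inner \<zeta> v)"
    by (intro continuous_intros)
  then obtain u where u: "u \<in> F \<alpha>" "\<forall>v\<in>F \<alpha>. - inner \<zeta> v \<le> - inner \<zeta> u"
    using continuous_attains_sup[OF compact nonempty] by blast
  then have "hamiltonian \<alpha> \<zeta> = - inner \<zeta> u"
    unfolding hamiltonian_def by (intro cSup_eq_maximum) auto
  then show "\<exists>v\<in>F \<alpha>. hamiltonian \<alpha> \<zeta> = - inner \<zeta> v"
    "v \<in> F \<alpha> \<Longrightarrow> - inner \<zeta> v \<le> hamiltonian \<alpha> \<zeta>"
    using u by auto
qed

text \<open>Speeds near \<open>\<alpha>\<close> are bounded, so a short trajectory cannot cover the
  distance to \<open>\<beta>\<close>.\<close>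

lemma min_time_pos:
  assumes "\<alpha> \<noteq> \<beta>"
  shows "min_time F (\<alpha>, \<beta>) > 0"
proof (rule ccontr)
  assume "\<not> ?thesis"
  then have zero: "min_time F (\<alpha>, \<beta>) \<le> ereal 0"
    by (simp add: zero_ereal_def)
  obtain \<rho> L M where est: "\<rho> > 0" "L \<ge> 0" "M > 0"
    "\<forall>x \<tau> t. trajectory_on F {0..\<tau>} x \<longrightarrow> norm (x 0 - \<alpha>) \<le> 1/2 \<longrightarrow> 0 \<le> t \<longrightarrow> t \<le> \<tau> \<longrightarrow> t \<le> \<rho> \<longrightarrow>
       norm (x t - x 0) \<le> M * t"
    "\<forall>x \<tau> t \<zeta> h. trajectory_on F {0..\<tau>} x \<longrightarrow> norm (x 0 - \<alpha>) \<le> 1/2 \<longrightarrow> 0 \<le> t \<longrightarrow> t \<le> \<tau> \<longrightarrow> t \<le> \<rho> \<longrightarrow>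
       (\<forall>v\<in>F \<alpha>. inner \<zeta> v \<le> h) \<longrightarrow>
       inner \<zeta> (x t - x 0) \<le> t * (h + norm \<zeta> * (L * (norm (x 0 - \<alpha>) + M * t)))"
    by (rule forward_estimate)
  \<comment> \<open>In time \<open>e\<close> at speed at most \<open>M\<close> a trajectory covers
    at most half the distance.\<close>
  define e where "e = min \<rho> (norm (\<beta> - \<alpha>) / (2 * M))"
  have "e > 0"
    using est assms by (simp add: e_def)
  from zero this obtain \<tau> x where x: "0 \<le> \<tau>" "\<tau> \<le> 0 + e" "trajectory_on F {0..\<tau>} x" "x 0 = \<alpha>" "x \<tau> = \<beta>"
    by (rule min_time_leE)
  then have "norm (x \<tau> - x 0) \<le> M * \<tau>"
    using est(4)[rule_format, of \<tau> x \<tau>] by (simp add: e_def)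
  also have "\<dots> \<le> M * (norm (\<beta> - \<alpha>) / (2 * M))"
    using x est by (intro mult_left_mono) (auto simp: e_def)
  also have "\<dots> = norm (\<beta> - \<alpha>) / 2"
    using est by simp
  finally show False
    using x assms by simp
qed

text \<open>
  Optimal trajectories are not needed: an \<open>s\<^sup>2\<close>-optimal one, followed for time \<open>s\<close>, loses only
  a term of order \<open>s\<^sup>2\<close>.
\<close>
lemma hamiltonian_ge_along_near_optimal:
  fixes \<zeta> :: 'a and \<mu> :: real
  assumes T: "min_time F (\<alpha>, \<beta>) = ereal T" and T0: "T > 0"
    and normal: "\<And>\<epsilon>. \<epsilon> > 0 \<Longrightarrow> \<exists>\<delta>>0. \<forall>s q. 0 < s \<longrightarrow> s \<le> 1 \<longrightarrow> norm (q - \<alpha>) + s < \<delta> \<longrightarrow>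
      min_time F (q, \<beta>) \<le> ereal (T - s + s\<^sup>2) \<longrightarrow>
      inner \<zeta> (q - \<alpha>) + \<mu> * (s\<^sup>2 - s) \<le> \<epsilon> * (norm (q - \<alpha>) + s)"
  shows "- \<mu> \<le> hamiltonian \<alpha> \<zeta>"
proof -
  obtain \<rho> L M where est: "\<rho> > 0" "L \<ge> 0" "M > 0"
    "\<forall>x \<tau> t. trajectory_on F {0..\<tau>} x \<longrightarrow> norm (x 0 - \<alpha>) \<le> 1/2 \<longrightarrow> 0 \<le> t \<longrightarrow> t \<le> \<tau> \<longrightarrow> t \<le> \<rho> \<longrightarrow>
       norm (x t - x 0) \<le> M * t"
    "\<forall>x \<tau> t \<zeta> h. trajectory_on F {0..\<tau>} x \<longrightarrow> norm (x 0 - \<alpha>) \<le> 1/2 \<longrightarrow> 0 \<le> t \<longrightarrow> t \<le> \<tau> \<longrightarrow> t \<le> \<rho> \<longrightarrow>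
       (\<forall>v\<in>F \<alpha>. inner \<zeta> v \<le> h) \<longrightarrow>
       inner \<zeta> (x t - x 0) \<le> t * (h + norm \<zeta> * (L * (norm (x 0 - \<alpha>) + M * t)))"
    by (rule forward_estimate)
  let ?h = "hamiltonian \<alpha> \<zeta>" and ?C = "norm \<zeta> * (L * M) - \<mu>"
  show ?thesis
  proof (rule le_of_small_errors[where K = "M + 1" and C = ?C])
    fix \<epsilon> :: real assume \<epsilon>: "\<epsilon> > 0"
    from normal[OF this] obtain \<delta> where \<delta>: "\<delta> > 0"
      "\<forall>s q. 0 < s \<longrightarrow> s \<le> 1 \<longrightarrow> norm (q - \<alpha>) + s < \<delta> \<longrightarrow>
        min_time F (q, \<beta>) \<le> ereal (T - s + s\<^sup>2) \<longrightarrow>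
        inner \<zeta> (q - \<alpha>) + \<mu> * (s\<^sup>2 - s) \<le> \<epsilon> * (norm (q - \<alpha>) + s)"
      by (elim exE conjE)
    \<comment> \<open>In turn: the range of the forward estimate, the time available on a trajectory
      of duration at least \<open>T\<close>, the range of \<open>s\<close> in the hypothesis, and
      \<open>norm (q - \<alpha>) + s < \<delta>\<close>, where the left side is at most
      \<open>(M + 1) * s\<close>.\<close>
    define \<sigma> where "\<sigma> = min (min \<rho> T) (min 1 (\<delta> / 2 / (M + 1)))"
    have \<sigma>: "\<sigma> > 0"
      using est T0 \<delta>(1) by (simp add: \<sigma>_def)
    have "- \<mu> \<le> ?h + (M + 1) * \<epsilon> + ?C * s" if s: "0 < s" "s \<le> \<sigma>" for s
    proof -
      have s': "s \<le> \<rho>" "s \<le> T" "s \<le> 1" "s \<le> \<delta> / 2 / (M + 1)"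
        using s by (auto simp: \<sigma>_def)
      have "s\<^sup>2 > 0"
        using s by simp
      moreover have "min_time F (\<alpha>, \<beta>) \<le> ereal T"
        using T by simp
      ultimately obtain \<tau> x where x: "0 \<le> \<tau>" "\<tau> \<le> T + s\<^sup>2" "trajectory_on F {0..\<tau>} x" "x 0 = \<alpha>" "x \<tau> = \<beta>"
        using min_time_leE[of F \<alpha> \<beta> T "s\<^sup>2"] by blast
      have "ereal T \<le> ereal \<tau>"
        using min_time_le[OF x(3,1,4,5)] T by simp
      then have \<tau>: "s \<le> \<tau>"
        using s' by simp
      define q where "q = x s"
      have "min_time F (q, \<beta>) \<le> ereal (\<tau> - s)"
        using min_time_along_trajectory[OF x(3), of s] s \<tau> x by (simp add: q_def)
      also have "\<dots> \<le> ereal (T - s + s\<^sup>2)"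
        using x by simp
      finally have q: "min_time F (q, \<beta>) \<le> ereal (T - s + s\<^sup>2)" .
      have qM: "norm (q - \<alpha>) \<le> M * s"
        using est(4)[rule_format, of \<tau> x s] x s s' \<tau> by (simp add: q_def)
      \<comment> \<open>With \<open>- \<zeta>\<close> the forward estimate becomes a lower bound for
        \<open>inner \<zeta> (q - \<alpha>)\<close>.\<close>
      have "inner (- \<zeta>) (x s - x 0) \<le> s * (?h + norm (- \<zeta>) * (L * (norm (x 0 - \<alpha>) + M * s)))"
        using x s s' \<tau> hamiltonian_upper[of _ \<alpha> \<zeta>] by (intro est(5)[rule_format, of \<tau>]) auto
      then have hq: "- inner \<zeta> (q - \<alpha>) \<le> s * (?h + norm \<zeta> * (L * (M * s)))"
        using x by (simp add: q_def)
      have "norm (q - \<alpha>) + s \<le> (M + 1) * s"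
        using qM by (simp add: algebra_simps)
      also have "\<dots> \<le> (M + 1) * (\<delta> / 2 / (M + 1))"
        using est s' by (intro mult_left_mono) auto
      also have "\<dots> = \<delta> / 2"
        using est(3) by (intro mult_half_divide) simp
      also have "\<dots> < \<delta>"
        using \<delta>(1) by simp
      finally have "inner \<zeta> (q - \<alpha>) + \<mu> * (s\<^sup>2 - s) \<le> \<epsilon> * (norm (q - \<alpha>) + s)"
        using \<delta>(2) s s' q by blast
      also have "\<dots> \<le> \<epsilon> * ((M + 1) * s)"
        using qM \<epsilon> by (intro mult_left_mono) (auto simp: algebra_simps)
      finally have "\<mu> * (s\<^sup>2 - s) \<le> \<epsilon> * ((M + 1) * s) + s * (?h + norm \<zeta> * (L * (M * s)))"
        using hq by linarith
      then have "s * (- \<mu>) \<le> s * (?h + (M + 1) * \<epsilon> + ?C * s)"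
        by (simp add: algebra_simps power2_eq_square)
      then show ?thesis
        using s by (simp only: mult_le_cancel_left_pos)
    qed
    then show "\<exists>\<rho>>0. \<forall>s. 0 < s \<longrightarrow> s \<le> \<rho> \<longrightarrow> - \<mu> \<le> ?h + (M + 1) * \<epsilon> + ?C * s"
      using \<sigma> by blast
  qed
qed

text \<open>The case \<open>\<mu> = 0\<close> of the preceding lemma:
  \<open>T - s + s\<^sup>2 \<le> T\<close> for \<open>s \<le> 1\<close>, so the points met along the
  trajectory remain in the sublevel set. The sign is used to enlarge the running time in
  \<open>normal_reachable_imp_normal_epi\<close>.\<close>

lemma hamiltonian_nonneg:
  assumes T: "min_time F (\<alpha>, \<beta>) = ereal T" and T0: "T > 0"
    and \<zeta>: "(\<zeta>1, \<zeta>2) \<in> frechet_normal_cone (reachable_within F T) (\<alpha>, \<beta>)"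
  shows "0 \<le> hamiltonian \<alpha> \<zeta>1"
proof -
  have "- 0 \<le> hamiltonian \<alpha> \<zeta>1"
  proof (rule hamiltonian_ge_along_near_optimal[OF T T0])
    fix \<epsilon> :: real assume \<epsilon>: "\<epsilon> > 0"
    then obtain \<delta> where \<delta>: "\<delta> > 0" "\<And>y. y \<in> reachable_within F T \<Longrightarrow> norm (y - (\<alpha>, \<beta>)) < \<delta> \<Longrightarrow>
        inner (\<zeta>1, \<zeta>2) (y - (\<alpha>, \<beta>)) \<le> \<epsilon> * norm (y - (\<alpha>, \<beta>))"
      using \<zeta> unfolding frechet_normal_cone_iff by blast
    have "inner \<zeta>1 (q - \<alpha>) + 0 * (s\<^sup>2 - s) \<le> \<epsilon> * (norm (q - \<alpha>) + s)"
      if s: "0 < s" "s \<le> 1" "norm (q - \<alpha>) + s < \<delta>" "min_time F (q, \<beta>) \<le> ereal (T - s + s\<^sup>2)" for s q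
    proof -
      have "s\<^sup>2 \<le> s"
        using s by (simp add: power2_eq_square mult_left_le_one_le)
      then have "min_time F (q, \<beta>) \<le> ereal T"
        using s(4) by (elim order_trans) simp
      then have "inner \<zeta>1 (q - \<alpha>) \<le> \<epsilon> * norm (q - \<alpha>)"
        using \<delta>(2)[of "(q, \<beta>)"] s by (simp add: mem_reachable_within)
      also have "\<dots> \<le> \<epsilon> * (norm (q - \<alpha>) + s)"
        using \<epsilon> s by (intro mult_left_mono) auto
      finally show ?thesis
        by simp
    qed
    then show "\<exists>\<delta>>0. \<forall>s q. 0 < s \<longrightarrow> s \<le> 1 \<longrightarrow> norm (q - \<alpha>) + s < \<delta> \<longrightarrow>
      min_time F (q, \<beta>) \<le> ereal (T - s + s\<^sup>2) \<longrightarrow>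
      inner \<zeta>1 (q - \<alpha>) + 0 * (s\<^sup>2 - s) \<le> \<epsilon> * (norm (q - \<alpha>) + s)"
      using \<delta>(1) by (intro exI[of _ \<delta>] conjI allI impI)
  qed
  then show ?thesis
    by simp
qed

text \<open>The normal is tested at the epigraph points
  \<open>((q, \<beta>), T - s + s\<^sup>2)\<close>, whose vertical displacement has size at most
  \<open>s\<close>.\<close>

lemma normal_epi_ge:
  assumes T: "min_time F (\<alpha>, \<beta>) = ereal T" and T0: "T > 0"
    and \<zeta>: "((\<zeta>1, \<zeta>2), \<mu>) \<in> frechet_normal_cone (min_time_epi F) ((\<alpha>, \<beta>), T)"
  shows "- \<mu> \<le> hamiltonian \<alpha> \<zeta>1"
proof (rule hamiltonian_ge_along_near_optimal[OF T T0])
  fix \<epsilon> :: real assume \<epsilon>: "\<epsilon> > 0"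
  let ?x = "((\<alpha>, \<beta>), T)"
  obtain \<delta> where \<delta>: "\<delta> > 0" "\<And>y. y \<in> min_time_epi F \<Longrightarrow> norm (y - ?x) < \<delta> \<Longrightarrow>
      inner ((\<zeta>1, \<zeta>2), \<mu>) (y - ?x) \<le> \<epsilon> * norm (y - ?x)"
    using \<zeta> \<epsilon> unfolding frechet_normal_cone_iff by blast
  have "inner \<zeta>1 (q - \<alpha>) + \<mu> * (s\<^sup>2 - s) \<le> \<epsilon> * (norm (q - \<alpha>) + s)"
    if s: "0 < s" "s \<le> 1" "norm (q - \<alpha>) + s < \<delta>" "min_time F (q, \<beta>) \<le> ereal (T - s + s\<^sup>2)" for s q
  proof -
    let ?y = "((q, \<beta>), T - s + s\<^sup>2)"
    have diff: "?y - ?x = ((q - \<alpha>, 0), s\<^sup>2 - s)"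
      by simp
    have "s\<^sup>2 \<le> s"
      using s by (simp add: power2_eq_square mult_left_le_one_le)
    then have "\<bar>s\<^sup>2 - s\<bar> \<le> s"
      by simp
    then have n: "norm (?y - ?x) \<le> norm (q - \<alpha>) + s"
      unfolding diff using norm_Pair_le[of "(q - \<alpha>, 0::'a)" "s\<^sup>2 - s"] by simp
    then have "inner ((\<zeta>1, \<zeta>2), \<mu>) (?y - ?x) \<le> \<epsilon> * norm (?y - ?x)"
      using s by (intro \<delta>(2)) (auto simp: mem_min_time_epi)
    also have "\<dots> \<le> \<epsilon> * (norm (q - \<alpha>) + s)"
      using \<epsilon> n by (intro mult_left_mono) auto
    finally show ?thesis
      unfolding diff by simp
  qed
  then show "\<exists>\<delta>>0. \<forall>s q. 0 < s \<longrightarrow> s \<le> 1 \<longrightarrow> norm (q - \<alpha>) + s < \<delta> \<longrightarrow>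
      min_time F (q, \<beta>) \<le> ereal (T - s + s\<^sup>2) \<longrightarrow>
      inner \<zeta>1 (q - \<alpha>) + \<mu> * (s\<^sup>2 - s) \<le> \<epsilon> * (norm (q - \<alpha>) + s)"
    using \<delta>(1) by (intro exI[of _ \<delta>] conjI allI impI)
qed

text \<open>The normal is tested at \<open>((z 0, \<beta>), T + s)\<close>, where \<open>z\<close>
  reaches \<open>\<alpha>\<close> in time \<open>s\<close> and is built from a velocity that attains
  the Hamiltonian.\<close>

lemma normal_epi_le:
  assumes T: "min_time F (\<alpha>, \<beta>) = ereal T"
    and \<zeta>: "((\<zeta>1, \<zeta>2), \<mu>) \<in> frechet_normal_cone (min_time_epi F) ((\<alpha>, \<beta>), T)"
  shows "hamiltonian \<alpha> \<zeta>1 \<le> - \<mu>"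
proof -
  obtain \<rho> K where bwd: "\<rho> > 0" "K \<ge> 0"
    "\<forall>x s v. norm (x - \<alpha>) \<le> \<rho> \<longrightarrow> 0 \<le> s \<longrightarrow> s \<le> \<rho> \<longrightarrow> v \<in> F \<alpha> \<longrightarrow>
      (\<exists>z. trajectory_on F {0..s} z \<and> z s = x \<and>
        norm (z 0 - (x - s *\<^sub>R v)) \<le> K * s * (norm (x - \<alpha>) + s))"
    by (rule backward_trajectory)
  obtain v where v: "v \<in> F \<alpha>" "hamiltonian \<alpha> \<zeta>1 = - inner \<zeta>1 v"
    using hamiltonian_attained by blast
  \<comment> \<open>\<open>?A * s\<close> bounds the distance of the test point from
    \<open>?x\<close>; \<open>?C * s\<close> is the backward error after division by
    \<open>s\<close>.\<close>
  let ?x = "((\<alpha>, \<beta>), T)" and ?A = "norm v + K + 1" and ?C = "norm \<zeta>1 * K"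
  show ?thesis
  proof (rule le_of_small_errors[where K = ?A and C = ?C])
    fix \<epsilon> :: real assume \<epsilon>: "\<epsilon> > 0"
    obtain \<delta> where \<delta>: "\<delta> > 0" "\<And>y. y \<in> min_time_epi F \<Longrightarrow> norm (y - ?x) < \<delta> \<Longrightarrow>
        inner ((\<zeta>1, \<zeta>2), \<mu>) (y - ?x) \<le> \<epsilon> * norm (y - ?x)"
      using \<zeta> \<epsilon> unfolding frechet_normal_cone_iff by blast
    have A: "?A > 0"
      using bwd by (simp add: add_nonneg_pos)
    define \<sigma> where "\<sigma> = min \<rho> (min 1 (\<delta> / 2 / ?A))"
    have \<sigma>: "\<sigma> > 0"
      using bwd A \<delta>(1) by (simp add: \<sigma>_def)
    have "hamiltonian \<alpha> \<zeta>1 \<le> - \<mu> + ?A * \<epsilon> + ?C * s" if s: "0 < s" "s \<le> \<sigma>" for s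
    proof -
      have s': "s \<le> \<rho>" "s \<le> 1" "s \<le> \<delta> / 2 / ?A"
        using s by (auto simp: \<sigma>_def)
      obtain z where z: "trajectory_on F {0..s} z" "z s = \<alpha>"
          "norm (z 0 - (\<alpha> - s *\<^sub>R v)) \<le> K * s * (norm (\<alpha> - \<alpha>) + s)"
        using bwd(3)[rule_format, of \<alpha> s v] bwd(1) s s' v(1) by auto
      define e where "e = z 0 - (\<alpha> - s *\<^sub>R v)"
      have e: "norm e \<le> K * s * s" "z 0 - \<alpha> = e - s *\<^sub>R v"
        using z by (simp_all add: e_def)
      let ?y = "((z 0, \<beta>), T + s)"
      have diff: "?y - ?x = ((z 0 - \<alpha>, 0), s)"
        by simp
      have epi: "?y \<in> min_time_epi F"
        unfolding mem_min_time_epi using T s by (intro min_time_prepend[OF _ z(1) _ z(2)]) auto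
      have "K * s * s \<le> K * s * 1"
        using s s' bwd by (intro mult_left_mono) auto
      then have "norm (z 0 - \<alpha>) \<le> K * s + s * norm v"
        using e norm_triangle_ineq4[of e "s *\<^sub>R v"] s by simp
      then have n: "norm (?y - ?x) \<le> ?A * s"
        unfolding diff using norm_Pair_le[of "(z 0 - \<alpha>, 0::'a)" s] s by (simp add: algebra_simps)
      also have "\<dots> \<le> ?A * (\<delta> / 2 / ?A)"
        using A s' by (intro mult_left_mono) auto
      also have "\<dots> = \<delta> / 2"
        using A by (intro mult_half_divide) simp
      also have "\<dots> < \<delta>"
        using \<delta>(1) by simp
      finally have "inner ((\<zeta>1, \<zeta>2), \<mu>) (?y - ?x) \<le> \<epsilon> * norm (?y - ?x)"
        using epi by (intro \<delta>(2)) auto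
      also have "\<dots> \<le> \<epsilon> * (?A * s)"
        using \<epsilon> n by (intro mult_left_mono) auto
      finally have 1: "inner \<zeta>1 (z 0 - \<alpha>) + \<mu> * s \<le> \<epsilon> * (?A * s)"
        unfolding diff by simp
      have "inner \<zeta>1 (- e) \<le> norm \<zeta>1 * (K * s * s)"
        using e by (intro inner_le_norm_mult) simp
      then have "s * hamiltonian \<alpha> \<zeta>1 \<le> inner \<zeta>1 (z 0 - \<alpha>) + norm \<zeta>1 * (K * s * s)"
        using v(2) e(2) by (simp add: inner_diff_right)
      with 1 have "s * hamiltonian \<alpha> \<zeta>1 \<le> s * (- \<mu> + ?A * \<epsilon> + ?C * s)"
        by (simp add: algebra_simps)
      then show ?thesis
        using s by (simp only: mult_le_cancel_left_pos)
    qed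
    then show "\<exists>\<rho>>0. \<forall>s. 0 < s \<longrightarrow> s \<le> \<rho> \<longrightarrow> hamiltonian \<alpha> \<zeta>1 \<le> - \<mu> + ?A * \<epsilon> + ?C * s"
      using \<sigma> by blast
  qed
qed

text \<open>The sublevel set is the slice of the epigraph at height \<open>T\<close>, and within
  this slice \<open>\<mu>\<close> does not contribute.\<close>

lemma normal_epi_imp_normal_reachable:
  assumes "(\<zeta>, \<mu>) \<in> frechet_normal_cone (min_time_epi F) (p, T)"
  shows "\<zeta> \<in> frechet_normal_cone (reachable_within F T) p"
  unfolding frechet_normal_cone_iff
proof (intro allI impI)
  fix \<epsilon> :: real assume \<epsilon>: "\<epsilon> > 0"
  then obtain \<delta> where \<delta>: "\<delta> > 0" "\<And>y. y \<in> min_time_epi F \<Longrightarrow> norm (y - (p, T)) < \<delta> \<Longrightarrow>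
      inner (\<zeta>, \<mu>) (y - (p, T)) \<le> \<epsilon> * norm (y - (p, T))"
    using assms unfolding frechet_normal_cone_iff by blast
  have "inner \<zeta> (y - p) \<le> \<epsilon> * norm (y - p)" if "y \<in> reachable_within F T" "norm (y - p) < \<delta>" for y
    using \<delta>(2)[of "(y, T)"] that by (simp add: mem_min_time_epi mem_reachable_within)
  then show "\<exists>\<delta>>0. \<forall>y\<in>reachable_within F T. norm (y - p) < \<delta> \<longrightarrow> inner \<zeta> (y - p) \<le> \<epsilon> * norm (y - p)"
    using \<delta>(1) by blast
qed

text \<open>For a point of height \<open>m\<close> the term \<open>- h * (m - T)\<close> offsets the
  change of \<open>inner \<zeta>1\<close> under the move into the sublevel set. If
  \<open>m \<le> T\<close>, the backward move with a maximizing \<open>v\<close> adds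
  \<open>(T - m) * h\<close> up to second order. If \<open>m > T\<close>, running forward for about
  \<open>m - T\<close> at most loses no more than \<open>(m - T) * h\<close> up to second
  order.\<close>

lemma normal_reachable_imp_normal_epi:
  assumes T: "min_time F (\<alpha>, \<beta>) = ereal T" and T0: "T > 0"
    and \<zeta>: "(\<zeta>1, \<zeta>2) \<in> frechet_normal_cone (reachable_within F T) (\<alpha>, \<beta>)"
  shows "((\<zeta>1, \<zeta>2), - hamiltonian \<alpha> \<zeta>1) \<in> frechet_normal_cone (min_time_epi F) ((\<alpha>, \<beta>), T)"
proof -
  obtain \<rho> K where bwd: "\<rho> > 0" "K \<ge> 0"
    "\<forall>x s v. norm (x - \<alpha>) \<le> \<rho> \<longrightarrow> 0 \<le> s \<longrightarrow> s \<le> \<rho> \<longrightarrow> v \<in> F \<alpha> \<longrightarrow>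
      (\<exists>z. trajectory_on F {0..s} z \<and> z s = x \<and>
        norm (z 0 - (x - s *\<^sub>R v)) \<le> K * s * (norm (x - \<alpha>) + s))"
    by (rule backward_trajectory)
  obtain \<rho>' L M where est: "\<rho>' > 0" "L \<ge> 0" "M > 0"
    "\<forall>x \<tau> t. trajectory_on F {0..\<tau>} x \<longrightarrow> norm (x 0 - \<alpha>) \<le> 1/2 \<longrightarrow> 0 \<le> t \<longrightarrow> t \<le> \<tau> \<longrightarrow> t \<le> \<rho>' \<longrightarrow>
       norm (x t - x 0) \<le> M * t"
    "\<forall>x \<tau> t \<zeta> h. trajectory_on F {0..\<tau>} x \<longrightarrow> norm (x 0 - \<alpha>) \<le> 1/2 \<longrightarrow> 0 \<le> t \<longrightarrow> t \<le> \<tau> \<longrightarrow> t \<le> \<rho>' \<longrightarrow>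
       (\<forall>v\<in>F \<alpha>. inner \<zeta> v \<le> h) \<longrightarrow>
       inner \<zeta> (x t - x 0) \<le> t * (h + norm \<zeta> * (L * (norm (x 0 - \<alpha>) + M * t)))"
    by (rule forward_estimate)
  define h n where "h = hamiltonian \<alpha> \<zeta>1" and "n = norm \<zeta>1"
  have h0: "0 \<le> h"
    using hamiltonian_nonneg[OF T T0 \<zeta>] by (simp add: h_def)
  obtain v where v: "v \<in> F \<alpha>" "h = - inner \<zeta>1 v"
    using hamiltonian_attained unfolding h_def by blast
  \<comment> \<open>\<open>A * d\<close> bounds the displacement of the moved point and
    \<open>C * d\<^sup>2\<close> the second order errors; each constant adds up the contributions of
    both cases.\<close>
  define A C where "A = 2 + norm v + 2 * K + 2 * M" and "C = 2 * n * K + h + 2 * n * L * (1 + 2 * M) + 1"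
  have n0: "0 \<le> n"
    by (simp add: n_def)
  have A: "A > 0"
    using bwd est norm_ge_zero[of v] unfolding A_def by linarith
  have Cterms: "0 \<le> n * K" "0 \<le> n * L * (1 + 2 * M)"
    using n0 bwd est by simp_all
  then have C: "C > 0"
    using h0 by (simp add: C_def)
  let ?x = "((\<alpha>, \<beta>), T)"
  show ?thesis
    unfolding frechet_normal_cone_iff h_def[symmetric]
  proof (intro allI impI)
    fix \<epsilon> :: real assume \<epsilon>: "\<epsilon> > 0"
    \<comment> \<open>Half of \<open>\<epsilon>\<close> is spent on the normal inequality through
      \<open>A\<close>, the other half on \<open>C * d\<^sup>2\<close>.\<close>
    define \<epsilon>' where "\<epsilon>' = \<epsilon> / (2 * A)"
    have \<epsilon>': "\<epsilon>' > 0"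
      using \<epsilon> A by (simp add: \<epsilon>'_def)
    then obtain \<delta>' where \<delta>': "\<delta>' > 0" "\<And>y. y \<in> reachable_within F T \<Longrightarrow> norm (y - (\<alpha>, \<beta>)) < \<delta>' \<Longrightarrow>
        inner (\<zeta>1, \<zeta>2) (y - (\<alpha>, \<beta>)) \<le> \<epsilon>' * norm (y - (\<alpha>, \<beta>))"
      using \<zeta> unfolding frechet_normal_cone_iff by blast
    \<comment> \<open>\<open>\<rho>' / 2\<close> is due to a forward running time of up to
      \<open>2 * d\<close>; 1/2 is the starting radius of the forward estimate and also gives
      \<open>d\<^sup>2 \<le> d\<close>.\<close>
    define \<delta> where "\<delta> = min (min (1/2) \<rho>) (min (\<rho>' / 2) (min (\<delta>' / A) (\<epsilon> / (2 * C))))"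
    have \<delta>0: "\<delta> > 0"
      using bwd est A C \<delta>'(1) \<epsilon> by (simp add: \<delta>_def)
    have "inner ((\<zeta>1, \<zeta>2), - h) (w - ?x) \<le> \<epsilon> * norm (w - ?x)"
      if w: "w \<in> min_time_epi F" "norm (w - ?x) < \<delta>" for w
    proof -
      obtain x y m where w_eq: "w = ((x, y), m)"
        by (metis prod.exhaust)
      define d where "d = norm (w - ?x)"
      have diff: "w - ?x = ((x - \<alpha>, y - \<beta>), m - T)"
        by (simp add: w_eq)
      have xm: "min_time F (x, y) \<le> ereal m"
        using w(1) by (simp add: w_eq mem_min_time_epi)
      have d: "0 \<le> d" "d \<le> 1/2" "d \<le> \<rho>" "2 * d \<le> \<rho>'" "d < \<delta>' / A" "d \<le> \<epsilon> / (2 * C)"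
        using w(2) by (auto simp: d_def \<delta>_def)
      have dx: "norm (x - \<alpha>) \<le> d" and dy: "norm (y - \<beta>) \<le> d" and dm: "\<bar>m - T\<bar> \<le> d"
        using norm_fst_le[of "(x - \<alpha>, y - \<beta>)" "m - T"] norm_snd_le[of "m - T" "(x - \<alpha>, y - \<beta>)"]
          norm_fst_le[of "x - \<alpha>" "y - \<beta>"] norm_snd_le[of "y - \<beta>" "x - \<alpha>"]
        unfolding d_def diff by auto
      have Ad: "A * d < \<delta>'"
        using d(5) A by (simp add: field_simps)
      have "C * d \<le> \<epsilon> / 2"
        using mult_left_mono[OF d(6), of C] C by simp
      from mult_right_mono[OF this d(1)] have Cd: "C * d\<^sup>2 \<le> \<epsilon> / 2 * d"
        by (simp add: power2_eq_square mult.assoc)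
      have Ad': "\<epsilon>' * (A * d) = \<epsilon> / 2 * d"
        using A by (simp add: \<epsilon>'_def)
      have normal: "inner \<zeta>1 (z - \<alpha>) + inner \<zeta>2 (y - \<beta>) \<le> \<epsilon> / 2 * d"
        if z: "min_time F (z, y) \<le> ereal T" "norm (z - \<alpha>) + norm (y - \<beta>) \<le> A * d" for z
      proof -
        have nz: "norm ((z, y) - (\<alpha>, \<beta>)) \<le> A * d"
          using norm_Pair_le[of "z - \<alpha>" "y - \<beta>"] z(2) by simp
        then have "inner (\<zeta>1, \<zeta>2) ((z, y) - (\<alpha>, \<beta>)) \<le> \<epsilon>' * norm ((z, y) - (\<alpha>, \<beta>))"
          using z(1) Ad by (intro \<delta>'(2)) (auto simp: mem_reachable_within)
        also have "\<dots> \<le> \<epsilon>' * (A * d)"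
          using nz \<epsilon>' by (intro mult_left_mono) auto
        finally show ?thesis
          by (simp add: Ad')
      qed
      have "inner \<zeta>1 (x - \<alpha>) + inner \<zeta>2 (y - \<beta>) - h * (m - T) \<le> \<epsilon> / 2 * d + C * d\<^sup>2"
      proof (cases "m \<le> T")
        case True
        define s where "s = T - m"
        have s: "0 \<le> s" "s \<le> d" "s \<le> \<rho>"
          using True dm d by (auto simp: s_def)
        obtain z where z: "trajectory_on F {0..s} z" "z s = x"
            "norm (z 0 - (x - s *\<^sub>R v)) \<le> K * s * (norm (x - \<alpha>) + s)"
          using bwd(3)[rule_format, of x s v] dx d s v(1) by auto
        define e where "e = z 0 - (x - s *\<^sub>R v)"
        have z_eq: "z 0 - \<alpha> = (x - \<alpha>) - s *\<^sub>R v + e"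
          by (simp add: e_def)
        have "K * s * (norm (x - \<alpha>) + s) \<le> K * d * (d + d)"
          using bwd s dx d by (intro mult_mono add_mono) auto
        then have e: "norm e \<le> 2 * K * d\<^sup>2"
          using z(3) by (simp add: e_def power2_eq_square algebra_simps)
        have "d\<^sup>2 \<le> d"
          using d by (simp add: power2_eq_square mult_left_le_one_le)
        then have e': "norm e \<le> 2 * K * d"
          using e mult_left_mono[of "d\<^sup>2" d "2 * K"] bwd by simp
        have "min_time F (z 0, y) \<le> ereal (m + s)"
          using xm z s by (intro min_time_prepend) auto
        then have reach: "min_time F (z 0, y) \<le> ereal T"
          by (simp add: s_def)
        have "norm (s *\<^sub>R v) \<le> d * norm v"
          using s by (auto intro: mult_right_mono)
        then have "norm (z 0 - \<alpha>) \<le> d + d * norm v + 2 * K * d"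
          unfolding z_eq using e' dx norm_triangle_ineq[of "x - \<alpha> - s *\<^sub>R v" e]
            norm_triangle_ineq4[of "x - \<alpha>" "s *\<^sub>R v"] by linarith
        then have "norm (z 0 - \<alpha>) + norm (y - \<beta>) \<le> (2 + norm v + 2 * K) * d"
          using dy by (simp add: algebra_simps)
        also have "\<dots> \<le> A * d"
          using d est by (intro mult_right_mono) (auto simp: A_def)
        finally have "inner \<zeta>1 (z 0 - \<alpha>) + inner \<zeta>2 (y - \<beta>) \<le> \<epsilon> / 2 * d"
          by (intro normal reach)
        moreover have "inner \<zeta>1 (- e) \<le> n * (2 * K * d\<^sup>2)"
          unfolding n_def using e by (intro inner_le_norm_mult) simp
        moreover have "inner \<zeta>1 (z 0 - \<alpha>) = inner \<zeta>1 (x - \<alpha>) + s * h + inner \<zeta>1 e"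
          unfolding z_eq using v(2) by (simp add: inner_diff_right inner_add_right)
        moreover have "h * (m - T) = - (s * h)"
          by (simp add: s_def algebra_simps)
        moreover have "n * (2 * K * d\<^sup>2) \<le> C * d\<^sup>2"
        proof -
          have "2 * n * K \<le> C"
            using h0 Cterms by (simp add: C_def)
          then have "2 * n * K * d\<^sup>2 \<le> C * d\<^sup>2"
            by (rule mult_right_mono) simp
          then show ?thesis
            by (simp add: mult_ac)
        qed
        ultimately show ?thesis
          by simp
      next
        case False
        define s where "s = m - T"
        have s: "0 < s" "s \<le> d"
          using False dm by (auto simp: s_def)
        have "s\<^sup>2 > 0"
          using s by simp
        from xm this obtain \<tau> X where X: "0 \<le> \<tau>" "\<tau> \<le> m + s\<^sup>2" "trajectory_on F {0..\<tau>} X" "X 0 = x" "X \<tau> = y"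
          by (rule min_time_leE)
        have s2: "s\<^sup>2 \<le> d\<^sup>2" "d\<^sup>2 \<le> d"
          using s d by (auto simp: power2_eq_square mult_left_le_one_le intro: mult_mono)
        \<comment> \<open>The time to run until at most \<open>T\<close> remains. The maximum covers
          a chosen trajectory that is shorter than \<open>T\<close> although
          \<open>m > T\<close>.\<close>
        define r where "r = max 0 (\<tau> - T)"
        have r: "0 \<le> r" "r \<le> \<tau>" "r \<le> s + s\<^sup>2"
          using X T0 s by (auto simp: r_def s_def)
        have r2d: "r \<le> 2 * d"
          using r(3) s(2) s2 by linarith
        define z where "z = X r"
        have x12: "norm (X 0 - \<alpha>) \<le> 1/2"
          using dx d X by simp
        have "min_time F (z, y) \<le> ereal (\<tau> - r)"
          using min_time_along_trajectory[OF X(3) r(1,2)] X by (simp add: z_def)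
        also have "\<dots> \<le> ereal T"
          by (simp add: r_def)
        finally have reach: "min_time F (z, y) \<le> ereal T" .
        have "norm (z - x) \<le> M * r"
          using est(4)[rule_format, OF X(3) x12 r(1,2)] r2d d X by (simp add: z_def)
        also have "\<dots> \<le> M * (2 * d)"
          using r2d est by (intro mult_left_mono) auto
        finally have "norm (z - \<alpha>) \<le> d + M * (2 * d)"
          using dx norm_triangle_ineq[of "z - x" "x - \<alpha>"] by simp
        then have "norm (z - \<alpha>) + norm (y - \<beta>) \<le> (2 + 2 * M) * d"
          using dy by (simp add: algebra_simps)
        also have "\<dots> \<le> A * d"
          using d bwd by (intro mult_right_mono) (auto simp: A_def)
        finally have nrm: "inner \<zeta>1 (z - \<alpha>) + inner \<zeta>2 (y - \<beta>) \<le> \<epsilon> / 2 * d"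
          by (intro normal reach)
        have "inner (- \<zeta>1) (X r - X 0) \<le> r * (h + norm (- \<zeta>1) * (L * (norm (X 0 - \<alpha>) + M * r)))"
          using r2d d hamiltonian_upper[of _ \<alpha> \<zeta>1]
          by (intro est(5)[rule_format, OF X(3) x12 r(1,2)]) (auto simp: h_def)
        then have "- inner \<zeta>1 (z - x) \<le> r * h + r * (n * (L * (norm (x - \<alpha>) + M * r)))"
          using X by (simp add: z_def n_def algebra_simps)
        \<comment> \<open>Only an upper bound for \<open>r\<close> is known, so this uses
          \<open>0 \<le> h\<close>.\<close>
        also have "r * h \<le> (s + d\<^sup>2) * h"
          using r s2 h0 by (intro mult_right_mono) auto
        also have "r * (n * (L * (norm (x - \<alpha>) + M * r))) \<le> 2 * d * (n * (L * (d + M * (2 * d))))"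
          using r r2d n0 est dx d by (intro mult_mono add_mono) auto
        also have "\<dots> = 2 * n * L * (1 + 2 * M) * d\<^sup>2"
          by (simp add: algebra_simps power2_eq_square)
        finally have inc: "- inner \<zeta>1 (z - x) \<le> s * h + (h + 2 * n * L * (1 + 2 * M)) * d\<^sup>2"
          by (simp add: algebra_simps)
        have "(h + 2 * n * L * (1 + 2 * M)) * d\<^sup>2 \<le> C * d\<^sup>2"
          using Cterms by (intro mult_right_mono) (auto simp: C_def)
        moreover have "inner \<zeta>1 (z - \<alpha>) = inner \<zeta>1 (z - x) + inner \<zeta>1 (x - \<alpha>)"
          by (simp add: inner_diff_right)
        moreover have "h * (m - T) = s * h"
          by (simp add: s_def)
        ultimately show ?thesis
          using nrm inc by linarith
      qed
      then show ?thesis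
        using Cd unfolding diff[symmetric] d_def[symmetric] by (simp add: diff)
    qed
    then show "\<exists>\<delta>>0. \<forall>w\<in>min_time_epi F. norm (w - ?x) < \<delta> \<longrightarrow>
        inner ((\<zeta>1, \<zeta>2), - h) (w - ?x) \<le> \<epsilon> * norm (w - ?x)"
      using \<delta>0 by blast
  qed
qed

end

text \<open>The closure conditions on the graph say that \<open>g\<close> is additive and positively
  homogeneous on \<open>C\<close>, so \<open>G\<close> preserves nonnegative combinations of
  elements of \<open>C\<close>; the zero condition accounts for the empty combination. The way back
  is the linear map \<open>fst\<close>.\<close>

lemma has_cone_dim_graph:
  fixes C :: "'a::euclidean_space set" and g :: "'a \<Rightarrow> real"
  defines "G \<equiv> \<lambda>x. (x, g x)"
  assumes zero: "0 \<in> G ` C"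
    and scale: "\<And>p c. p \<in> G ` C \<Longrightarrow> 0 \<le> c \<Longrightarrow> c *\<^sub>R p \<in> G ` C"
    and add: "\<And>p q. p \<in> G ` C \<Longrightarrow> q \<in> G ` C \<Longrightarrow> p + q \<in> G ` C"
  shows "has_cone_dim C \<kappa> \<longleftrightarrow> has_cone_dim (G ` C) \<kappa>"
proof -
  have inj: "inj_on G B" for B
    by (simp add: G_def inj_on_def)
  have fst_G: "fst (G b) = b" for b
    by (simp add: G_def)
  have coneG: "cone (G ` C)"
    using scale unfolding cone_def by blast
  have coneC: "cone C"
    unfolding cone_def
  proof (intro ballI allI impI)
    fix x and c :: real assume "x \<in> C" "0 \<le> c"
    then have "c *\<^sub>R G x \<in> G ` C"
      by (intro scale) auto
    then show "c *\<^sub>R x \<in> C"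
      by (auto simp: G_def)
  qed
  have sum_G: "(\<Sum>b\<in>B. c b *\<^sub>R G b) = (\<Sum>b\<in>B. c b *\<^sub>R b, \<Sum>b\<in>B. c b * g b)" for B c
    by (simp add: G_def sum_prod)
  have comb: "(\<Sum>b\<in>B. c b *\<^sub>R G b) \<in> G ` C" if "finite B" "B \<subseteq> C" "\<forall>b\<in>B. 0 \<le> c b" for B c
    using that
  proof (induction B rule: finite_induct)
    case empty
    then show ?case
      using zero by simp
  next
    case (insert b B)
    then show ?case
      by (auto intro!: add scale)
  qed
  have g_comb: "g (\<Sum>b\<in>B. c b *\<^sub>R b) = (\<Sum>b\<in>B. c b * g b)"
    if "finite B" "B \<subseteq> C" "\<forall>b\<in>B. 0 \<le> c b" for B c
    using comb[OF that] unfolding sum_G by (auto simp: G_def)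
  have G_comb: "G (\<Sum>b\<in>B. c b *\<^sub>R b) = (\<Sum>b\<in>B. c b *\<^sub>R G b)"
    if "finite B" "B \<subseteq> C" "\<forall>b\<in>B. 0 \<le> c b" for B c
    using g_comb[OF that] unfolding sum_G by (simp add: G_def)
  have indep: "independent B \<longleftrightarrow> independent (G ` B)" if B: "finite B" "B \<subseteq> C" for B
  proof
    assume ind: "independent B"
    show "independent (G ` B)"
    proof (rule independent_if_scalars_zero)
      fix f p assume f: "(\<Sum>p\<in>G ` B. f p *\<^sub>R p) = 0" and "p \<in> G ` B"
      then obtain b where b: "b \<in> B" "p = G b"
        by blast
      have "(\<Sum>b\<in>B. f (G b) *\<^sub>R G b) = 0"
        using f by (simp add: sum.reindex[OF inj] o_def)
      then have "(\<Sum>b\<in>B. f (G b) *\<^sub>R b) = 0"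
        unfolding sum_G by (simp add: zero_prod_def)
      then show "f p = 0"
        using independentD[OF ind B(1) order_refl, of "\<lambda>b. f (G b)" b] b by simp
    qed (use B in simp)
  next
    assume ind: "independent (G ` B)"
    show "independent B"
    proof (rule independent_if_scalars_zero)
      fix f b assume f: "(\<Sum>b\<in>B. f b *\<^sub>R b) = 0" and b: "b \<in> B"
      have f_eq: "f b = max (f b) 0 - max (- f b) 0" for b
        by simp
      \<comment> \<open>\<open>g\<close> is only additive on the cone, so the relation is split into two nonnegative halves.\<close>
      have "(\<Sum>b\<in>B. max (f b) 0 *\<^sub>R b) - (\<Sum>b\<in>B. max (- f b) 0 *\<^sub>R b) = (\<Sum>b\<in>B. f b *\<^sub>R b)"
        by (simp add: sum_subtractf[symmetric] scaleR_left_diff_distrib[symmetric] f_eq[symmetric])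
      then have "(\<Sum>b\<in>B. max (f b) 0 *\<^sub>R b) = (\<Sum>b\<in>B. max (- f b) 0 *\<^sub>R b)"
        using f by simp
      then have "(\<Sum>b\<in>B. max (f b) 0 *\<^sub>R G b) = (\<Sum>b\<in>B. max (- f b) 0 *\<^sub>R G b)"
        using G_comb[OF B, of "\<lambda>b. max (f b) 0"] G_comb[OF B, of "\<lambda>b. max (- f b) 0"] by simp
      then have "(\<Sum>b\<in>B. (max (f b) 0 - max (- f b) 0) *\<^sub>R G b) = 0"
        by (simp add: scaleR_left_diff_distrib sum_subtractf)
      then have "(\<Sum>p\<in>G ` B. f (fst p) *\<^sub>R p) = 0"
        unfolding f_eq[symmetric] by (simp add: sum.reindex[OF inj] fst_G)
      then show "f b = 0"
        using independentD[OF ind _ order_refl, of "\<lambda>p. f (fst p)" "G b"] B(1) b by (simp add: fst_G)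
    qed (rule B)
  qed
  have gen: "(\<forall>v\<in>C. \<exists>c. (\<forall>b\<in>B. 0 \<le> c b) \<and> v = (\<Sum>b\<in>B. c b *\<^sub>R b)) \<longleftrightarrow>
      (\<forall>p\<in>G ` C. \<exists>c. (\<forall>q\<in>G ` B. 0 \<le> c q) \<and> p = (\<Sum>q\<in>G ` B. c q *\<^sub>R q))" (is "?l \<longleftrightarrow> ?r")
    if B: "finite B" "B \<subseteq> C" for B
  proof
    assume l: ?l
    show ?r
    proof
      fix p assume "p \<in> G ` C"
      then obtain v where v: "v \<in> C" "p = G v"
        by blast
      then obtain c where c: "\<forall>b\<in>B. 0 \<le> c b" "v = (\<Sum>b\<in>B. c b *\<^sub>R b)"
        using l by blast
      have "p = (\<Sum>q\<in>G ` B. c (fst q) *\<^sub>R q)"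
        using G_comb[OF B c(1)] c(2) v(2) by (simp add: sum.reindex[OF inj] fst_G)
      then show "\<exists>c. (\<forall>q\<in>G ` B. 0 \<le> c q) \<and> p = (\<Sum>q\<in>G ` B. c q *\<^sub>R q)"
        using c(1) by (intro exI[of _ "\<lambda>q. c (fst q)"]) (auto simp: fst_G)
    qed
  next
    assume r: ?r
    show ?l
    proof
      fix v assume "v \<in> C"
      then obtain c where c: "\<forall>q\<in>G ` B. 0 \<le> c q" "G v = (\<Sum>q\<in>G ` B. c q *\<^sub>R q)"
        using r by blast
      have "G v = (\<Sum>b\<in>B. c (G b) *\<^sub>R G b)"
        using c(2) by (simp add: sum.reindex[OF inj])
      then have "v = (\<Sum>b\<in>B. c (G b) *\<^sub>R b)"
        unfolding sum_G by (simp add: G_def)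
      then show "\<exists>c. (\<forall>b\<in>B. 0 \<le> c b) \<and> v = (\<Sum>b\<in>B. c b *\<^sub>R b)"
        using c(1) by (intro exI[of _ "\<lambda>b. c (G b)"]) simp
    qed
  qed
  \<comment> \<open>Subsets of the image are exactly the images of subsets, so the candidate
    generating sets on the two sides correspond.\<close>
  have image: "(\<exists>B\<subseteq>C. P (G ` B)) \<longleftrightarrow> (\<exists>E\<subseteq>G ` C. P E)" for P
    by (metis image_mono subset_imageE)
  have "(\<exists>B\<subseteq>C. finite B \<and> card B = \<kappa> \<and> independent B \<and>
        (\<forall>v\<in>C. \<exists>c. (\<forall>b\<in>B. 0 \<le> c b) \<and> v = (\<Sum>b\<in>B. c b *\<^sub>R b))) \<longleftrightarrow>
      (\<exists>B\<subseteq>C. finite (G ` B) \<and> card (G ` B) = \<kappa> \<and> independent (G ` B) \<and>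
        (\<forall>p\<in>G ` C. \<exists>c. (\<forall>q\<in>G ` B. 0 \<le> c q) \<and> p = (\<Sum>q\<in>G ` B. c q *\<^sub>R q)))"
    using indep gen by (intro ex_cong1) (auto simp: card_image[OF inj] finite_image_iff[OF inj])
  also have "\<dots> \<longleftrightarrow> (\<exists>E\<subseteq>G ` C. finite E \<and> card E = \<kappa> \<and> independent E \<and>
        (\<forall>p\<in>G ` C. \<exists>c. (\<forall>q\<in>E. 0 \<le> c q) \<and> p = (\<Sum>q\<in>E. c q *\<^sub>R q)))"
    by (rule image)
  finally show ?thesis
    using coneC coneG unfolding has_cone_dim_def by simp
qed

section \<open>The epigraph cone as a graph, and equality of dimensions\<close>

context lipschitz_inclusion
begin

lemma normal_epi_eq_graph:
  assumes T: "min_time F (\<alpha>, \<beta>) = ereal T" and T0: "T > 0"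
  shows "frechet_normal_cone (min_time_epi F) ((\<alpha>, \<beta>), T) =
    (\<lambda>\<zeta>. (\<zeta>, - hamiltonian \<alpha> (fst \<zeta>))) ` frechet_normal_cone (reachable_within F T) (\<alpha>, \<beta>)"
proof (intro set_eqI iffI)
  fix w assume w: "w \<in> frechet_normal_cone (min_time_epi F) ((\<alpha>, \<beta>), T)"
  obtain \<zeta>1 \<zeta>2 \<mu> where w_eq: "w = ((\<zeta>1, \<zeta>2), \<mu>)"
    by (metis prod.exhaust)
  have "\<mu> = - hamiltonian \<alpha> \<zeta>1"
    using normal_epi_ge[OF T T0] normal_epi_le[OF T] w unfolding w_eq by fastforce
  moreover have "(\<zeta>1, \<zeta>2) \<in> frechet_normal_cone (reachable_within F T) (\<alpha>, \<beta>)"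
    using w unfolding w_eq by (rule normal_epi_imp_normal_reachable)
  ultimately show "w \<in> (\<lambda>\<zeta>. (\<zeta>, - hamiltonian \<alpha> (fst \<zeta>))) ` frechet_normal_cone (reachable_within F T) (\<alpha>, \<beta>)"
    unfolding w_eq by force
next
  fix w assume "w \<in> (\<lambda>\<zeta>. (\<zeta>, - hamiltonian \<alpha> (fst \<zeta>))) ` frechet_normal_cone (reachable_within F T) (\<alpha>, \<beta>)"
  then show "w \<in> frechet_normal_cone (min_time_epi F) ((\<alpha>, \<beta>), T)"
    using normal_reachable_imp_normal_epi[OF T T0] by auto
qed

end

theorem theorem3p9:
  fixes F :: "real ^ 'n \<Rightarrow> (real ^ 'n) set"
    and \<alpha> \<beta> :: "real ^ 'n"
  assumes F1: "\<And>x. F x \<noteq> {} \<and> compact (F x) \<and> convex (F x)"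
    and F2: "\<And>K. compact K \<Longrightarrow> \<exists>L. \<forall>x\<in>K. \<forall>y\<in>K.
               F x \<subseteq> {v + (L * norm (y - x)) *\<^sub>R b | v b. v \<in> F y \<and> b \<in> cball 0 1}"
    and F3: "\<exists>\<gamma>>0. \<exists>c>0. \<forall>x. \<forall>v\<in>F x. norm v \<le> \<gamma> * norm x + c"
    and reach: "(\<alpha>, \<beta>) \<in> reachable_set F"
    and neq: "\<alpha> \<noteq> \<beta>"
  shows "\<forall>\<kappa>.
    has_cone_dim
      (frechet_normal_cone (reachable_within F (real_of_ereal (min_time F (\<alpha>, \<beta>)))) (\<alpha>, \<beta>)) \<kappa>
    \<longleftrightarrow>
    has_cone_dim
      (frechet_normal_cone (min_time_epi F) ((\<alpha>, \<beta>), real_of_ereal (min_time F (\<alpha>, \<beta>)))) \<kappa>"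
proof -
  interpret lipschitz_inclusion F
  proof
    fix a :: "real ^ 'n"
    obtain L where L: "\<forall>x\<in>cball a 1. \<forall>y\<in>cball a 1.
        F x \<subseteq> {v + (L * norm (y - x)) *\<^sub>R b | v b. v \<in> F y \<and> b \<in> cball 0 1}"
      using F2[of "cball a 1"] by auto
    \<comment> \<open>The constant from (F2) may be negative, hence the absolute value.\<close>
    have "\<exists>w\<in>F y. norm (u - w) \<le> \<bar>L\<bar> * norm (x - y)"
      if xy: "x \<in> cball a 1" "y \<in> cball a 1" "u \<in> F x" for x y u
    proof -
      have "u \<in> {v + (L * norm (y - x)) *\<^sub>R b | v b. v \<in> F y \<and> b \<in> cball 0 1}"
        using L xy by blast
      then obtain v b where vb: "u = v + (L * norm (y - x)) *\<^sub>R b" "v \<in> F y" "norm b \<le> 1"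
        by auto
      have "norm (u - v) = \<bar>L\<bar> * norm (x - y) * norm b"
        using vb(1) by (simp add: abs_mult norm_minus_commute)
      also have "\<dots> \<le> \<bar>L\<bar> * norm (x - y) * 1"
        using vb(3) by (intro mult_left_mono) auto
      finally show ?thesis
        using vb(2) by auto
    qed
    then show "\<exists>L. \<forall>x\<in>cball a 1. \<forall>y\<in>cball a 1. \<forall>u\<in>F x. \<exists>w\<in>F y. norm (u - w) \<le> L * norm (x - y)"
      by blast
  qed (use F1 in auto)
  define T where "T = real_of_ereal (min_time F (\<alpha>, \<beta>))"
  \<comment> \<open>Reachability excludes plus infinity and nonnegativity excludes minus infinity,
    so \<open>real_of_ereal\<close> loses nothing.\<close>
  have T: "min_time F (\<alpha>, \<beta>) = ereal T"
    using reach min_time_nonneg[of F "(\<alpha>, \<beta>)"] unfolding T_def reachable_set_def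
    by (cases "min_time F (\<alpha>, \<beta>)") auto
  have T0: "T > 0"
    using min_time_pos[OF neq] unfolding T by simp
  let ?C = "frechet_normal_cone (reachable_within F T) (\<alpha>, \<beta>)"
  let ?D = "frechet_normal_cone (min_time_epi F) ((\<alpha>, \<beta>), T)"
  note graph = normal_epi_eq_graph[OF T T0]
  have "has_cone_dim ?C \<kappa> \<longleftrightarrow> has_cone_dim ?D \<kappa>" for \<kappa>
    unfolding graph
  \<comment> \<open>Folding the image back into \<open>?D\<close> turns the conditions on the graph
    into closure properties of a normal cone.\<close>
  proof (rule has_cone_dim_graph; unfold graph[symmetric])
    show "0 \<in> ?D"
      unfolding frechet_normal_cone_iff by (auto intro!: exI[of _ 1])
  qed (auto intro: frechet_normal_cone_scaleR frechet_normal_cone_add)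
  then show ?thesis
    unfolding T_def by blast
qed

end
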